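(* Let $K$ be a field with involution, let $\mathcal{G}$ be an ample Hausdorff groupoid with compact unit space $\mathcal{G}^{(0)}$, let $\Gamma$ be a discrete group with identity $\varepsilon$, and let $c:\mathcal{G}\rightarrow\Gamma$ be a cocycle such that $c^{-1}(\varepsilon)$ is strongly effective. Then the Steinberg algebra $A_K(\mathcal{G})$ is a graded quasi-Baer $\ast$-ring if and only if for every open invariant subset $U$ of $\mathcal{G}^{(0)}$, $U$ or $\mathrm{Int}(\mathcal{G}^{(0)}\setminus U)$ is compact.
   Context: Rings. An involution on a ring $R$ is a map $\ast:R\to R$ with $(x+y)^*=x^*+y^*$, $(xy)^*=y^*x^*$, $(x^* )^*=x$; a ring with an involution is a $\ast$-ring. A projection is an element $p$ with $p=p^2=p^*$. A $\Gamma$-graded ring is $R=\bigoplus_{g\in\Gamma}R_g$ with additive subgroups $R_g$ satisfying $R_gR_h\subseteq R_{gh}$; homogeneous elements are those of $\bigcup_g R_g$; an ideal $I$ is graded if $I=\bigoplus_g (I\cap R_g)$. A graded $\ast$-ring is a graded ring with an involution such that $R_g^*\subseteq R_{g^{-1}}$ for all $g$. For $X\subseteq R$, $r_R(X)=\{r\in R\mid xr=0 \text{ for all } x\in X\}$. A graded $\ast$-ring $R$ is a graded quasi-Baer $\ast$-ring if for every graded (two-sided) ideal $I$ of $R$, $r_R(I)$ is generated by a homogeneous projection, i.e. $r_R(I)=pR$ for some homogeneous projection $p$. Groupoids. A groupoid $\mathcal{G}$ is a small category with all morphisms invertible; $\mathcal{G}^{(0)}=\{\gamma^{-1}\gamma\mid\gamma\in\mathcal{G}\}$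 is the unit space, with $s(\gamma)=\gamma^{-1}\gamma$, $r(\gamma)=\gamma\gamma^{-1}$, and $\mathcal{G}^{(2)}=\{(\gamma,\alpha)\mid s(\gamma)=r(\alpha)\}$. A topological groupoid has continuous inversion and composition. It is étale if $r$ is a local homeomorphism from $\mathcal{G}$ to $\mathcal{G}^{(0)}$. An open bisection is an open $U\subseteq\mathcal{G}$ such that $s|_U$ and $r|_U$ are homeomorphisms onto open subsets of $\mathcal{G}^{(0)}$. An étale groupoid is ample if its topology has a basis of compact open bisections. $\mathrm{Iso}(\mathcal{G})=\{\gamma\mid s(\gamma)=r(\gamma)\}$. A subset $U\subseteq\mathcal{G}^{(0)}$ is invariant if $s(\gamma)\in U$ implies $r(\gamma)\in U$; then $\mathcal{G}|_U=\{\gamma\in\mathcal{G}\mid s(\gamma)\in U\}$. An ample Hausdorff groupoid is effective if the interior of $\mathrm{Iso}(\mathcal{G})$ equals $\mathcal{G}^{(0)}$, and strongly effective if $\mathcal{G}|_U$ is effective for every closed invariant subset $U\subseteq\mathcal{G}^{(0)}$. A cocycle is a continuous map $c:\mathcal{G}\to\Gamma$ with $c(\gamma\alpha)=c(\gamma)c(\alpha)$ for all $(\gamma,\alpha)\in\mathcal{G}^{(2)}$; $c^{-1}(\varepsilon)$ is regarded as an ample Hausdorff groupoid with the same unit space. Steinberg algebra. $A_K(\mathcal{G})=\mathrm{span}_K\{1_U\mid U\text{ a compact open bisection of }\mathcal{G}\}$, the space of compactly supported locally constant functions $\mathcal{G}\to K$, with pointwise addition, convolution $(f*g)(\gamma)=\sum_{\alpha\beta=\gamma}f(\alpha)g(\beta)$,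 involution $f^*(\gamma)=\overline{f(\gamma^{-1})}$ (where $\overline{\phantom{x}}$ is the involution of $K$), and grading $A_K(\mathcal{G})_g=\{f\mid f(\gamma)\neq0\Rightarrow c(\gamma)=g\}$. $\mathrm{Int}$ denotes the topological interior in $\mathcal{G}^{(0)}$. *)

theory Defs
  imports "HOL-Algebra.Ideal" "HOL-Analysis.T1_Spaces"
begin

section \<open>Graded rings with involution\<close>

definition ring_involution :: "('a, 'm) ring_scheme \<Rightarrow> ('a \<Rightarrow> 'a) \<Rightarrow> bool" where
  "ring_involution R star \<longleftrightarrow>
     star \<in> carrier R \<rightarrow> carrier R \<and>
     (\<forall>x\<in>carrier R. \<forall>y\<in>carrier R. star (x \<oplus>\<^bsub>R\<^esub> y) = star x \<oplus>\<^bsub>R\<^esub> star y) \<and>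
     (\<forall>x\<in>carrier R. \<forall>y\<in>carrier R. star (x \<otimes>\<^bsub>R\<^esub> y) = star y \<otimes>\<^bsub>R\<^esub> star x) \<and>
     (\<forall>x\<in>carrier R. star (star x) = x)"

definition projection :: "('a, 'm) ring_scheme \<Rightarrow> ('a \<Rightarrow> 'a) \<Rightarrow> 'a \<Rightarrow> bool" where
  "projection R star p \<longleftrightarrow> p \<in> carrier R \<and> p = p \<otimes>\<^bsub>R\<^esub> p \<and> p = star p"

text \<open>
  \<open>S\<close> is the internal direct sum of the \<open>A i\<close>: the summation map from the external direct sum
  (finitely supported families) to \<open>S\<close> is bijective.
\<close>

definition internal_direct_sum ::
    "('a, 'm) ring_scheme \<Rightarrow> 'i set \<Rightarrow> ('i \<Rightarrow> 'a set) \<Rightarrow> 'a set \<Rightarrow> bool" where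
  "internal_direct_sum R I A S \<longleftrightarrow>
     bij_betw (\<lambda>d. finsum R d {i\<in>I. d i \<noteq> \<zero>\<^bsub>R\<^esub>})
       {d \<in> \<Pi>\<^sub>E i\<in>I. A i. finite {i\<in>I. d i \<noteq> \<zero>\<^bsub>R\<^esub>}} S"

locale graded_ring = ring R + \<Gamma>: group \<Gamma>
  for R :: "('a, 'm) ring_scheme" (structure) and \<Gamma> :: "('c, 'n) monoid_scheme" +
  fixes grade :: "'c \<Rightarrow> 'a set"
  assumes grade_additive_subgroup: "g \<in> carrier \<Gamma> \<Longrightarrow> additive_subgroup (grade g) R"
    and grade_mult: "\<lbrakk>g \<in> carrier \<Gamma>; h \<in> carrier \<Gamma>; x \<in> grade g; y \<in> grade h\<rbrakk>
                     \<Longrightarrow> x \<otimes> y \<in> grade (g \<otimes>\<^bsub>\<Gamma>\<^esub> h)"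
    and grade_direct_sum: "internal_direct_sum R (carrier \<Gamma>) grade (carrier R)"

definition homogeneous :: "('c, 'n) monoid_scheme \<Rightarrow> ('c \<Rightarrow> 'a set) \<Rightarrow> 'a \<Rightarrow> bool" where
  "homogeneous \<Gamma> grade x \<longleftrightarrow> (\<exists>g\<in>carrier \<Gamma>. x \<in> grade g)"

definition graded_ideal ::
    "('a, 'm) ring_scheme \<Rightarrow> ('c, 'n) monoid_scheme \<Rightarrow> ('c \<Rightarrow> 'a set) \<Rightarrow> 'a set \<Rightarrow> bool" where
  "graded_ideal R \<Gamma> grade I \<longleftrightarrow>
     ideal I R \<and> internal_direct_sum R (carrier \<Gamma>) (\<lambda>g. I \<inter> grade g) I"

definition right_annihilator :: "('a, 'm) ring_scheme \<Rightarrow> 'a set \<Rightarrow> 'a set" where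
  "right_annihilator R X = {r \<in> carrier R. \<forall>x\<in>X. x \<otimes>\<^bsub>R\<^esub> r = \<zero>\<^bsub>R\<^esub>}"

locale graded_star_ring = graded_ring +
  fixes star :: "'a \<Rightarrow> 'a"
  assumes star_involution: "ring_involution R star"
    and star_grade: "g \<in> carrier \<Gamma> \<Longrightarrow> star ` grade g \<subseteq> grade (inv\<^bsub>\<Gamma>\<^esub> g)"

locale graded_quasi_Baer_star_ring = graded_star_ring +
  assumes quasi_Baer: "graded_ideal R \<Gamma> grade I \<Longrightarrow>
    \<exists>p. projection R star p \<and> homogeneous \<Gamma> grade p \<and>
        right_annihilator R I = (\<lambda>r. p \<otimes> r) ` carrier R"


section \<open>Topological groupoids\<close>

text \<open>
  A groupoid is given by its morphisms only, the objects being identified with the identity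
  morphisms.  The morphisms are the points of the topology; \<open>gmult\<close> is meaningful only on
  composable pairs.
\<close>

record 'g tgroupoid =
  gtop :: "'g topology"
  gmult :: "'g \<Rightarrow> 'g \<Rightarrow> 'g"
  ginv :: "'g \<Rightarrow> 'g"

definition arrows :: "('g, 'x) tgroupoid_scheme \<Rightarrow> 'g set" where
  "arrows G = topspace (gtop G)"

definition gsrc :: "('g, 'x) tgroupoid_scheme \<Rightarrow> 'g \<Rightarrow> 'g" where
  "gsrc G a = gmult G (ginv G a) a"

definition grng :: "('g, 'x) tgroupoid_scheme \<Rightarrow> 'g \<Rightarrow> 'g" where
  "grng G a = gmult G a (ginv G a)"

definition gunits :: "('g, 'x) tgroupoid_scheme \<Rightarrow> 'g set" where
  "gunits G = gsrc G ` arrows G"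

definition composable :: "('g, 'x) tgroupoid_scheme \<Rightarrow> ('g \<times> 'g) set" where
  "composable G = {(a, b). a \<in> arrows G \<and> b \<in> arrows G \<and> gsrc G a = grng G b}"

definition unit_top :: "('g, 'x) tgroupoid_scheme \<Rightarrow> 'g topology" where
  "unit_top G = subtopology (gtop G) (gunits G)"

locale groupoid =
  fixes G :: "('g, 'x) tgroupoid_scheme"
  assumes mult_closed: "(a, b) \<in> composable G \<Longrightarrow> gmult G a b \<in> arrows G"
    and src_mult: "(a, b) \<in> composable G \<Longrightarrow> gsrc G (gmult G a b) = gsrc G b"
    and rng_mult: "(a, b) \<in> composable G \<Longrightarrow> grng G (gmult G a b) = grng G a"
    and mult_assoc: "\<lbrakk>(a, b) \<in> composable G; (b, d) \<in> composable G\<rbrakk>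
          \<Longrightarrow> gmult G (gmult G a b) d = gmult G a (gmult G b d)"
    and src_closed: "a \<in> arrows G \<Longrightarrow> gsrc G a \<in> arrows G"
    and rng_closed: "a \<in> arrows G \<Longrightarrow> grng G a \<in> arrows G"
    and src_src: "a \<in> arrows G \<Longrightarrow> gsrc G (gsrc G a) = gsrc G a"
    and rng_src: "a \<in> arrows G \<Longrightarrow> grng G (gsrc G a) = gsrc G a"
    and src_rng: "a \<in> arrows G \<Longrightarrow> gsrc G (grng G a) = grng G a"
    and rng_rng: "a \<in> arrows G \<Longrightarrow> grng G (grng G a) = grng G a"
    and mult_src: "a \<in> arrows G \<Longrightarrow> gmult G a (gsrc G a) = a"
    and rng_mult_self: "a \<in> arrows G \<Longrightarrow> gmult G (grng G a) a = a"
    and inv_closed: "a \<in> arrows G \<Longrightarrow> ginv G a \<in> arrows G"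
    and src_inv: "a \<in> arrows G \<Longrightarrow> gsrc G (ginv G a) = grng G a"
    and rng_inv: "a \<in> arrows G \<Longrightarrow> grng G (ginv G a) = gsrc G a"

locale topological_groupoid = groupoid +
  assumes continuous_inv: "continuous_map (gtop G) (gtop G) (ginv G)"
    and continuous_mult:
      "continuous_map (subtopology (prod_topology (gtop G) (gtop G)) (composable G)) (gtop G)
         (\<lambda>(a, b). gmult G a b)"

definition local_homeomorphism :: "'a topology \<Rightarrow> 'b topology \<Rightarrow> ('a \<Rightarrow> 'b) \<Rightarrow> bool" where
  "local_homeomorphism X Y f \<longleftrightarrow>
     (\<forall>x\<in>topspace X. \<exists>U. openin X U \<and> x \<in> U \<and> openin Y (f ` U) \<and>
        homeomorphic_map (subtopology X U) (subtopology Y (f ` U)) f)"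

locale etale_groupoid = topological_groupoid +
  assumes local_homeomorphism_rng: "local_homeomorphism (gtop G) (unit_top G) (grng G)"

definition open_bisection :: "('g, 'x) tgroupoid_scheme \<Rightarrow> 'g set \<Rightarrow> bool" where
  "open_bisection G U \<longleftrightarrow> openin (gtop G) U \<and>
     openin (unit_top G) (gsrc G ` U) \<and>
     homeomorphic_map (subtopology (gtop G) U) (subtopology (unit_top G) (gsrc G ` U)) (gsrc G) \<and>
     openin (unit_top G) (grng G ` U) \<and>
     homeomorphic_map (subtopology (gtop G) U) (subtopology (unit_top G) (grng G ` U)) (grng G)"

definition compact_open_bisection :: "('g, 'x) tgroupoid_scheme \<Rightarrow> 'g set \<Rightarrow> bool" where
  "compact_open_bisection G U \<longleftrightarrow> open_bisection G U \<and> compactin (gtop G) U"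

locale ample_groupoid = etale_groupoid +
  assumes compact_open_bisection_base:
    "openin (gtop G) = arbitrary union_of compact_open_bisection G"

definition isotropy :: "('g, 'x) tgroupoid_scheme \<Rightarrow> 'g set" where
  "isotropy G = {a \<in> arrows G. gsrc G a = grng G a}"

definition invariant :: "('g, 'x) tgroupoid_scheme \<Rightarrow> 'g set \<Rightarrow> bool" where
  "invariant G U \<longleftrightarrow> U \<subseteq> gunits G \<and> (\<forall>a\<in>arrows G. gsrc G a \<in> U \<longrightarrow> grng G a \<in> U)"

definition subgroupoid_on :: "('g, 'x) tgroupoid_scheme \<Rightarrow> 'g set \<Rightarrow> ('g, 'x) tgroupoid_scheme" where
  "subgroupoid_on G S = G\<lparr>gtop := subtopology (gtop G) S\<rparr>"

definition restrict_units :: "('g, 'x) tgroupoid_scheme \<Rightarrow> 'g set \<Rightarrow> ('g, 'x) tgroupoid_scheme" where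
  "restrict_units G U = subgroupoid_on G {a \<in> arrows G. gsrc G a \<in> U}"

definition effective :: "('g, 'x) tgroupoid_scheme \<Rightarrow> bool" where
  "effective G \<longleftrightarrow> gtop G interior_of isotropy G = gunits G"

definition strongly_effective :: "('g, 'x) tgroupoid_scheme \<Rightarrow> bool" where
  "strongly_effective G \<longleftrightarrow>
     (\<forall>U. closedin (unit_top G) U \<and> invariant G U \<longrightarrow> effective (restrict_units G U))"

definition cocycle ::
    "('g, 'x) tgroupoid_scheme \<Rightarrow> ('c, 'n) monoid_scheme \<Rightarrow> ('g \<Rightarrow> 'c) \<Rightarrow> bool" where
  "cocycle G \<Gamma> c \<longleftrightarrow>
     continuous_map (gtop G) (discrete_topology (carrier \<Gamma>)) c \<and>
     (\<forall>(a, b)\<in>composable G. c (gmult G a b) = c a \<otimes>\<^bsub>\<Gamma>\<^esub> c b)"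

definition cocycle_kernel ::
    "('g, 'x) tgroupoid_scheme \<Rightarrow> ('c, 'n) monoid_scheme \<Rightarrow> ('g \<Rightarrow> 'c) \<Rightarrow> ('g, 'x) tgroupoid_scheme" where
  "cocycle_kernel G \<Gamma> c = subgroupoid_on G {a \<in> arrows G. c a = \<one>\<^bsub>\<Gamma>\<^esub>}"


section \<open>Steinberg algebras\<close>

text \<open>
  Functions on the groupoid are total functions on the ambient type that vanish off the morphisms,
  so that equality of functions is equality of elements of the algebra.
\<close>

definition char_fun :: "('k, 'm) ring_scheme \<Rightarrow> 'g set \<Rightarrow> 'g \<Rightarrow> 'k" where
  "char_fun K U = (\<lambda>a. if a \<in> U then \<one>\<^bsub>K\<^esub> else \<zero>\<^bsub>K\<^esub>)"

inductive_set steinberg_span :: "('k, 'm) ring_scheme \<Rightarrow> ('g, 'x) tgroupoid_scheme \<Rightarrow> ('g \<Rightarrow> 'k) set"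
  for K :: "('k, 'm) ring_scheme" and G :: "('g, 'x) tgroupoid_scheme" where
  zero: "(\<lambda>a. \<zero>\<^bsub>K\<^esub>) \<in> steinberg_span K G"
| char_fun: "compact_open_bisection G U \<Longrightarrow> char_fun K U \<in> steinberg_span K G"
| add: "\<lbrakk>f \<in> steinberg_span K G; h \<in> steinberg_span K G\<rbrakk>
          \<Longrightarrow> (\<lambda>a. f a \<oplus>\<^bsub>K\<^esub> h a) \<in> steinberg_span K G"
| scale: "\<lbrakk>k \<in> carrier K; f \<in> steinberg_span K G\<rbrakk>
          \<Longrightarrow> (\<lambda>a. k \<otimes>\<^bsub>K\<^esub> f a) \<in> steinberg_span K G"

text \<open>
  The sum over all factorisations \<open>a b = x\<close> has only finitely many nonzero terms for \<open>f\<close>, \<open>h\<close> in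
  the algebra; as \<open>finsum\<close> over an infinite index set is zero, the index set is cut down to those
  factorisations on which both functions are nonzero.
\<close>

definition convolution ::
    "('k, 'm) ring_scheme \<Rightarrow> ('g, 'x) tgroupoid_scheme \<Rightarrow> ('g \<Rightarrow> 'k) \<Rightarrow> ('g \<Rightarrow> 'k) \<Rightarrow> 'g \<Rightarrow> 'k" where
  "convolution K G f h = (\<lambda>x. finsum K (\<lambda>(a, b). f a \<otimes>\<^bsub>K\<^esub> h b)
     {(a, b) \<in> composable G. gmult G a b = x \<and> f a \<noteq> \<zero>\<^bsub>K\<^esub> \<and> h b \<noteq> \<zero>\<^bsub>K\<^esub>})"

text \<open>
  The field \<open>one\<close> is the identity of the algebra when the unit space is compact; otherwise the
  algebra has no identity and the record does not satisfy \<open>ring\<close>.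
\<close>

definition steinberg_algebra ::
    "('k, 'm) ring_scheme \<Rightarrow> ('g, 'x) tgroupoid_scheme \<Rightarrow> ('g \<Rightarrow> 'k) ring" where
  "steinberg_algebra K G =
     \<lparr>carrier = steinberg_span K G,
      mult = convolution K G,
      one = char_fun K (gunits G),
      zero = (\<lambda>a. \<zero>\<^bsub>K\<^esub>),
      add = (\<lambda>f h a. f a \<oplus>\<^bsub>K\<^esub> h a)\<rparr>"

definition steinberg_star ::
    "('k, 'm) ring_scheme \<Rightarrow> ('k \<Rightarrow> 'k) \<Rightarrow> ('g, 'x) tgroupoid_scheme \<Rightarrow> ('g \<Rightarrow> 'k) \<Rightarrow> 'g \<Rightarrow> 'k" where
  "steinberg_star K \<sigma> G f = (\<lambda>a. if a \<in> arrows G then \<sigma> (f (ginv G a)) else \<zero>\<^bsub>K\<^esub>)"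

definition steinberg_grade ::
    "('k, 'm) ring_scheme \<Rightarrow> ('g, 'x) tgroupoid_scheme \<Rightarrow> ('g \<Rightarrow> 'c) \<Rightarrow> 'c \<Rightarrow> ('g \<Rightarrow> 'k) set" where
  "steinberg_grade K G c g = {f \<in> steinberg_span K G. \<forall>a. f a \<noteq> \<zero>\<^bsub>K\<^esub> \<longrightarrow> c a = g}"

end

theory Submission
  imports Defs
begin

text \<open>
  Elements of the algebra are the compactly supported locally constant functions, and convolution
  by the indicator of a compact open bisection is a translation; by linearity the ring axioms reduce
  to such translations.

  Let \<open>I\<close> be a graded ideal, \<open>U\<close> the set of sources of arrows at which some element of \<open>I\<close> is nonzero,
  and \<open>V\<close> the interior of the complement of \<open>U\<close> in the unit space.  Translating a homogeneous element
  of \<open>I\<close> into degree \<open>\<epsilon>\<close> and cutting it down by a small set of units, effectiveness of \<open>c\<^sup>-\<^sup>1(\<epsilon>)\<close> removes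
  its part off the units, so every open set meeting \<open>U\<close> contains a nonempty compact open \<open>W\<close> with
  \<open>1\<^sub>W \<in> I\<close>.  Hence \<open>r(I)\<close> consists of the functions supported on arrows with range in \<open>V\<close>.  If \<open>V\<close> is
  compact, this is \<open>1\<^sub>V A\<close>.  Conversely, for open invariant \<open>U\<close> a projection generating the annihilator of
  the functions supported over \<open>U\<close> must be \<open>1\<close> on \<open>V\<close> and \<open>0\<close> on the other units, so \<open>V\<close> is clopen.
  Finally, if an open set \<open>U\<close> of units is compact then it is clopen, and then \<open>V\<close> is compact as well.
\<close>

section \<open>Groupoids and their bisections\<close>

text \<open>Continuity and openness are global properties of \<open>f\<close>, so only injectivity
  has to be checked on \<open>U\<close>. For source and range this makes being a bisection a matter
  of openness and injectivity.\<close>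

lemma homeomorphic_map_of_open_map:
  assumes f: "continuous_map X Y f" "open_map X Y f" and U: "openin X U" "inj_on f U"
  shows "homeomorphic_map (subtopology X U) (subtopology Y (f ` U)) f"
proof (rule bijective_open_imp_homeomorphic_map)
  have fU: "openin Y (f ` U)" using f(2) U(1) by (simp add: open_map_def)
  then have "U \<subseteq> topspace X" "f ` U \<subseteq> topspace Y" using U(1) openin_subset by auto
  then show "f ` topspace (subtopology X U) = topspace (subtopology Y (f ` U))"
    and "inj_on f (topspace (subtopology X U))"
    using U(2) by (simp_all add: Int_absorb1)
  show "continuous_map (subtopology X U) (subtopology Y (f ` U)) f"
    using f(1) by (auto simp: continuous_map_in_subtopology continuous_map_from_subtopology)
  show "open_map (subtopology X U) (subtopology Y (f ` U)) f"
    using f(2) U(1) fU by (simp add: open_map_def openin_open_subtopology image_mono)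
qed

text \<open>The inverse homeomorphism, with its codomain enlarged to \<open>X\<close>. For a
  bisection it selects continuously the one arrow over a given source or range.\<close>

lemma homeomorphic_map_section:
  assumes "homeomorphic_map (subtopology X U) (subtopology Y (f ` U)) f" "U \<subseteq> topspace X"
  obtains \<phi> where "continuous_map (subtopology Y (f ` U)) X \<phi>" "\<And>u. u \<in> U \<Longrightarrow> \<phi> (f u) = u"
proof -
  obtain \<phi> where "homeomorphic_maps (subtopology X U) (subtopology Y (f ` U)) f \<phi>"
    using assms(1) by (auto simp: homeomorphic_map_maps)
  then show thesis
    using that [of \<phi>] assms(2)
    by (simp add: homeomorphic_maps_def continuous_map_in_subtopology Int_absorb1)
qed

section \<open>Cancellation, inverses and units in a groupoid\<close>

context groupoid
begin

abbreviation gprod (infixl "\<cdot>" 70) where "a \<cdot> b \<equiv> gmult G a b"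
abbreviation src where "src \<equiv> gsrc G"
abbreviation rng where "rng \<equiv> grng G"
abbreviation ginverse where "ginverse \<equiv> ginv G"
abbreviation Arr where "Arr \<equiv> arrows G"

lemma composableI: "\<lbrakk>a \<in> Arr; b \<in> Arr; src a = rng b\<rbrakk> \<Longrightarrow> (a, b) \<in> composable G"
  by (simp add: composable_def)

lemma mult_simps [simp]:
  assumes "a \<in> Arr" "b \<in> Arr" "src a = rng b"
  shows "a \<cdot> b \<in> Arr" "src (a \<cdot> b) = src b" "rng (a \<cdot> b) = rng a"
  using assms by (auto intro: mult_closed src_mult rng_mult composableI)

lemma assoc:
  assumes "a \<in> Arr" "b \<in> Arr" "d \<in> Arr" "src a = rng b" "src b = rng d"
  shows "a \<cdot> b \<cdot> d = a \<cdot> (b \<cdot> d)"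
  using assms by (auto intro: mult_assoc composableI)

declare src_closed [simp] rng_closed [simp] src_src [simp] rng_src [simp] src_rng [simp]
  rng_rng [simp] mult_src [simp] rng_mult_self [simp] inv_closed [simp] src_inv [simp] rng_inv [simp]

lemma inv_mult_self: "ginverse a \<cdot> a = src a"
  by (simp add: gsrc_def)

lemma mult_inv_self: "a \<cdot> ginverse a = rng a"
  by (simp add: grng_def)

lemma inv_inv [simp]:
  assumes "a \<in> Arr"
  shows "ginverse (ginverse a) = a"
proof -
  let ?b = "ginverse (ginverse a)"
  have "?b = ?b \<cdot> src ?b" using assms by (simp del: src_inv)
  also have "\<dots> = ?b \<cdot> (ginverse a \<cdot> a)" using assms by (simp add: inv_mult_self)
  also have "\<dots> = ?b \<cdot> ginverse a \<cdot> a" using assms by (simp add: assoc)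
  also have "\<dots> = a" using assms by (simp add: inv_mult_self)
  finally show ?thesis .
qed

lemma inv_mult_cancel_left [simp]:
  assumes "a \<in> Arr" "b \<in> Arr" "src a = rng b"
  shows "ginverse a \<cdot> (a \<cdot> b) = b"
  using assms by (simp add: assoc [symmetric] inv_mult_self)

lemma mult_inv_cancel_left [simp]:
  assumes "a \<in> Arr" "b \<in> Arr" "rng a = rng b"
  shows "a \<cdot> (ginverse a \<cdot> b) = b"
  using assms by (simp add: assoc [symmetric] mult_inv_self)

lemma inv_mult_cancel_right [simp]:
  assumes "a \<in> Arr" "b \<in> Arr" "src a = src b"
  shows "a \<cdot> ginverse b \<cdot> b = a"
  using assms by (simp add: assoc inv_mult_self) (metis mult_src)

lemma inv_unique:
  assumes "a \<in> Arr" "b \<in> Arr" "src a = rng b" "a \<cdot> b = src b"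
  shows "b = ginverse a"
proof -
  have "b = ginverse a \<cdot> (a \<cdot> b)" using assms(1-3) by simp
  also have "\<dots> = ginverse a \<cdot> src b" using assms by simp
  \<comment> \<open>Taking ranges in \<open>a \<cdot> b = src b\<close> gives
    \<open>rng a = src b\<close>, so \<open>src b\<close> is the right unit of
    \<open>ginverse a\<close>.\<close>
  also have "src b = src (ginverse a)"
    using assms mult_simps(3) [of a b] by (metis rng_src src_inv)
  finally show ?thesis using assms(1) by (metis inv_closed mult_src)
qed

lemma inv_mult:
  assumes "a \<in> Arr" "b \<in> Arr" "src a = rng b"
  shows "ginverse (a \<cdot> b) = ginverse b \<cdot> ginverse a"
proof (rule inv_unique [symmetric])
  show "a \<cdot> b \<cdot> (ginverse b \<cdot> ginverse a) = src (ginverse b \<cdot> ginverse a)"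
    using assms by (simp add: assoc mult_inv_self)
qed (use assms in simp_all)

lemma units_eq: "gunits G = {x \<in> Arr. src x = x}"
  by (force simp: gunits_def)

lemma units_sub: "gunits G \<subseteq> Arr"
  by (auto simp: units_eq)

lemma unit_simps [simp]:
  assumes "x \<in> gunits G"
  shows "x \<in> Arr" "src x = x" "rng x = x" "ginverse x = x"
proof -
  show x: "x \<in> Arr" "src x = x" using assms by (auto simp: units_eq)
  show r: "rng x = x" using x rng_src by metis
  show "ginverse x = x" using x r inv_mult_self [of x] mult_src [of "ginverse x"] by simp
qed

lemma src_unit [simp]: "a \<in> Arr \<Longrightarrow> src a \<in> gunits G"
  and rng_unit [simp]: "a \<in> Arr \<Longrightarrow> rng a \<in> gunits G"
  by (simp_all add: units_eq del: unit_simps)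

lemma unit_mult: "\<lbrakk>x \<in> gunits G; a \<in> Arr; rng a = x\<rbrakk> \<Longrightarrow> x \<cdot> a = a"
  by auto

text \<open>Invariance is defined in one direction; the other comes from the inverse arrow.\<close>

lemma invariant_rng_iff:
  assumes "invariant G U" "a \<in> Arr"
  shows "rng a \<in> U \<longleftrightarrow> src a \<in> U"
  using assms by (metis invariant_def inv_closed rng_inv src_inv)

end

section \<open>Continuity of source and range\<close>

context topological_groupoid
begin

lemma topspace_gtop [simp]: "topspace (gtop G) = Arr"
  by (simp add: arrows_def)

lemma openin_gtop_Arr [simp]: "openin (gtop G) Arr" and closedin_gtop_Arr [simp]: "closedin (gtop G) Arr"
  using openin_topspace [of "gtop G"] closedin_topspace [of "gtop G"] by simp_all

text \<open>Multiplication is continuous only on composable pairs, so the pairing of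
  \<open>f\<close> and \<open>h\<close> is factored through that subspace of the product.\<close>

lemma continuous_map_mult:
  assumes f: "continuous_map X (gtop G) f" and h: "continuous_map X (gtop G) h"
    and fh: "\<And>x. x \<in> topspace X \<Longrightarrow> src (f x) = rng (h x)"
  shows "continuous_map X (gtop G) (\<lambda>x. f x \<cdot> h x)"
proof -
  have "f x \<in> Arr" "h x \<in> Arr" if "x \<in> topspace X" for x
    using continuous_map_image_subset_topspace [OF f] continuous_map_image_subset_topspace [OF h] that
    by auto
  then have "continuous_map X (subtopology (prod_topology (gtop G) (gtop G)) (composable G)) (\<lambda>x. (f x, h x))"
    using f h fh by (auto simp: continuous_map_in_subtopology continuous_map_paired composable_def)
  from continuous_map_compose [OF this continuous_mult] show ?thesis
    by (simp add: o_def)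
qed

lemma continuous_src: "continuous_map (gtop G) (unit_top G) src"
proof -
  have "continuous_map (gtop G) (gtop G) (\<lambda>a. ginverse a \<cdot> a)"
    by (rule continuous_map_mult) (auto simp: continuous_inv)
  then show ?thesis
    by (auto simp: unit_top_def continuous_map_in_subtopology inv_mult_self)
qed

lemma continuous_rng: "continuous_map (gtop G) (unit_top G) rng"
proof -
  have "continuous_map (gtop G) (unit_top G) (src \<circ> ginverse)"
    by (rule continuous_map_compose [OF continuous_inv continuous_src])
  then show ?thesis
    by (rule continuous_map_eq) simp
qed

lemma topspace_unit_top [simp]: "topspace (unit_top G) = gunits G"
  using units_sub by (auto simp: unit_top_def)

lemma openin_Arr: "openin (gtop G) U \<Longrightarrow> U \<subseteq> Arr"
  using openin_subset by fastforce

end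

section \<open>Compact open bisections and translation by them\<close>

context ample_groupoid
begin

lemma cob_Arr: "compact_open_bisection G U \<Longrightarrow> U \<subseteq> Arr"
  by (auto simp: compact_open_bisection_def open_bisection_def dest: openin_Arr)

lemma ex_cob:
  assumes "openin (gtop G) W" "a \<in> W"
  obtains B where "compact_open_bisection G B" "a \<in> B" "B \<subseteq> W"
  using assms unfolding compact_open_bisection_base union_of_def by auto

text \<open>Near a unit take a bisection \<open>B\<close>. An arrow of \<open>B\<close> whose range
  again lies in \<open>B\<close> equals that range, because both have the same range and
  \<open>rng\<close> is injective on \<open>B\<close>.\<close>

lemma openin_gtop_units: "openin (gtop G) (gunits G)"
proof (subst openin_subopen, intro ballI)
  fix x assume x: "x \<in> gunits G"
  then obtain B where B: "compact_open_bisection G B" "x \<in> B"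
    by (metis ex_cob openin_topspace topspace_gtop unit_simps(1))
  then have o: "openin (gtop G) B" and inj: "inj_on rng B"
    by (auto simp: compact_open_bisection_def open_bisection_def homeomorphic_map_def
        dest!: openin_Arr Int_absorb1)
  let ?T = "{a \<in> Arr. rng a \<in> B \<inter> gunits G} \<inter> B"
  have "openin (unit_top G) (B \<inter> gunits G)"
    unfolding unit_top_def using o by (auto simp: openin_subtopology)
  from openin_continuous_map_preimage [OF continuous_rng this]
  have "openin (gtop G) ?T" using o by auto
  moreover have "x \<in> ?T" using x B by simp
  moreover have "?T \<subseteq> gunits G"
  proof
    fix a assume "a \<in> ?T"
    then have a: "a \<in> Arr" "rng a \<in> B" "a \<in> B" by auto
    then have "rng a = a" using inj_onD [OF inj, of "rng a" a] by simp
    then show "a \<in> gunits G" using rng_unit [OF a(1)] by simp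
  qed
  ultimately show "\<exists>T. openin (gtop G) T \<and> x \<in> T \<and> T \<subseteq> gunits G" by blast
qed

lemma openin_unit_top: "openin (unit_top G) W \<longleftrightarrow> openin (gtop G) W \<and> W \<subseteq> gunits G"
  by (simp add: unit_top_def openin_open_subtopology openin_gtop_units)

lemma compactin_unit_top: "compactin (unit_top G) W \<longleftrightarrow> compactin (gtop G) W \<and> W \<subseteq> gunits G"
  by (simp add: unit_top_def compactin_subtopology)

lemma openin_vimage_unit_top:
  assumes f: "continuous_map (gtop G) (unit_top G) f" and W: "openin (gtop G) W"
  shows "openin (gtop G) {a \<in> Arr. f a \<in> W}"
proof -
  have "openin (unit_top G) (W \<inter> gunits G)"
    using W openin_gtop_units by (simp add: openin_unit_top openin_Int)
  from openin_continuous_map_preimage [OF f this]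
  have "openin (gtop G) {a \<in> Arr. f a \<in> W \<inter> gunits G}" by simp
  moreover have "f a \<in> gunits G" if "a \<in> Arr" for a
    using continuous_map_image_subset_topspace [OF f] that by auto
  then have "{a \<in> Arr. f a \<in> W \<inter> gunits G} = {a \<in> Arr. f a \<in> W}" by blast
  ultimately show ?thesis by simp
qed

lemmas openin_src_vimage = openin_vimage_unit_top [OF continuous_src]
lemmas openin_rng_vimage = openin_vimage_unit_top [OF continuous_rng]

text \<open>Images commute with unions, so openness may be tested on a basis. On compact open
  bisections it is part of the definition for \<open>src\<close> and \<open>rng\<close>.\<close>

lemma open_map_of_local:
  assumes "\<And>B. compact_open_bisection G B \<Longrightarrow> openin (unit_top G) (f ` B)"
  shows "open_map (gtop G) (unit_top G) f"
  unfolding open_map_def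
proof (intro allI impI)
  fix W assume W: "openin (gtop G) W"
  show "openin (unit_top G) (f ` W)"
  proof (subst openin_subopen, intro ballI)
    fix y assume "y \<in> f ` W"
    then obtain a where a: "a \<in> W" "y = f a" by auto
    obtain B where B: "compact_open_bisection G B" "a \<in> B" "B \<subseteq> W"
      using ex_cob W a by blast
    then show "\<exists>T. openin (unit_top G) T \<and> y \<in> T \<and> T \<subseteq> f ` W"
      using assms a by blast
  qed
qed

lemma open_map_src: "open_map (gtop G) (unit_top G) src"
  by (rule open_map_of_local) (simp add: compact_open_bisection_def open_bisection_def)

lemma open_map_rng: "open_map (gtop G) (unit_top G) rng"
  by (rule open_map_of_local) (simp add: compact_open_bisection_def open_bisection_def)

text \<open>Source and range are continuous and open on the whole groupoid, which leaves injectivity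
  as the only content of the two homeomorphism conditions.\<close>

lemma open_bisection_iff:
  "open_bisection G U \<longleftrightarrow> openin (gtop G) U \<and> inj_on src U \<and> inj_on rng U"
proof
  assume "open_bisection G U"
  then show "openin (gtop G) U \<and> inj_on src U \<and> inj_on rng U"
    by (auto simp: open_bisection_def homeomorphic_map_def dest!: openin_Arr Int_absorb1)
next
  assume *: "openin (gtop G) U \<and> inj_on src U \<and> inj_on rng U"
  then show "open_bisection G U"
    unfolding open_bisection_def
    using homeomorphic_map_of_open_map [OF continuous_src open_map_src]
      homeomorphic_map_of_open_map [OF continuous_rng open_map_rng]
      open_map_src open_map_rng
    by (auto simp: open_map_def)
qed

lemma cob_iff:
  "compact_open_bisection G U \<longleftrightarrow>
     openin (gtop G) U \<and> compactin (gtop G) U \<and> inj_on src U \<and> inj_on rng U"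
  by (auto simp: compact_open_bisection_def open_bisection_iff)

lemma cob_subset:
  assumes "compact_open_bisection G U" "V \<subseteq> U" "openin (gtop G) V" "compactin (gtop G) V"
  shows "compact_open_bisection G V"
  using assms inj_on_subset [OF _ assms(2)] by (auto simp: cob_iff)

lemma cob_units:
  assumes "openin (gtop G) V" "compactin (gtop G) V" "V \<subseteq> gunits G"
  shows "compact_open_bisection G V"
proof -
  have "src a = a" "rng a = a" if "a \<in> V" for a using that assms(3) unit_simps by blast+
  then show ?thesis using assms by (simp add: cob_iff inj_on_def)
qed

text \<open>
  Left translation by a bisection \<open>U\<close> is a homeomorphism from the arrows with range in \<open>src ` U\<close>
  to those with range in \<open>rng ` U\<close>; it is described here by its graph.
\<close>

lemma translation_compact:
  assumes U: "compact_open_bisection G U" and C: "compactin (gtop G) C" "\<And>y. y \<in> C \<Longrightarrow> rng y \<in> src ` U"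
  shows "compactin (gtop G) {u \<cdot> y | u y. u \<in> U \<and> y \<in> C \<and> src u = rng y}"
proof -
  \<comment> \<open>\<open>\<phi>\<close> picks the arrow of \<open>U\<close> with a given source,
    so that translation becomes the continuous map sending \<open>y\<close> to
    \<open>\<phi> (rng y) \<cdot> y\<close>.\<close>
  obtain \<phi> where \<phi>: "continuous_map (subtopology (unit_top G) (src ` U)) (gtop G) \<phi>"
    "\<And>u. u \<in> U \<Longrightarrow> \<phi> (src u) = u" 
    using U homeomorphic_map_section [of "gtop G" U "unit_top G" src] cob_Arr [OF U]
    by (auto simp: compact_open_bisection_def open_bisection_def)
  let ?X = "subtopology (gtop G) {y \<in> Arr. rng y \<in> src ` U}"
  have "continuous_map ?X (subtopology (unit_top G) (src ` U)) rng"
    by (auto simp: continuous_map_in_subtopology continuous_map_from_subtopology continuous_rng)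
  from continuous_map_compose [OF this \<phi>(1)]
  have "continuous_map ?X (gtop G) (\<lambda>y. \<phi> (rng y))" by (simp add: o_def)
  then have "continuous_map ?X (gtop G) (\<lambda>y. \<phi> (rng y) \<cdot> y)"
    by (rule continuous_map_mult) (auto simp: continuous_map_from_subtopology \<phi>(2))
  moreover have "C \<subseteq> Arr" using C(1) compactin_subset_topspace by fastforce
  then have "compactin ?X C" using C by (auto simp: compactin_subtopology)
  ultimately have "compactin (gtop G) ((\<lambda>y. \<phi> (rng y) \<cdot> y) ` C)"
    using image_compactin by blast
  also have "(\<lambda>y. \<phi> (rng y) \<cdot> y) ` C = {u \<cdot> y | u y. u \<in> U \<and> y \<in> C \<and> src u = rng y}"
  proof (intro Set.set_eqI iffI)
    fix x assume "x \<in> (\<lambda>y. \<phi> (rng y) \<cdot> y) ` C"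
    then obtain y where y: "y \<in> C" "x = \<phi> (rng y) \<cdot> y" by auto
    then obtain u where "u \<in> U" "src u = rng y" using C by force
    then show "x \<in> {u \<cdot> y | u y. u \<in> U \<and> y \<in> C \<and> src u = rng y}" using y \<phi>(2) by fastforce
  next
    fix x assume "x \<in> {u \<cdot> y | u y. u \<in> U \<and> y \<in> C \<and> src u = rng y}"
    then show "x \<in> (\<lambda>y. \<phi> (rng y) \<cdot> y) ` C" using \<phi>(2) by force
  qed
  finally show ?thesis .
qed

lemma translation_open:
  assumes U: "compact_open_bisection G U" and W: "openin (gtop G) W"
  shows "openin (gtop G) {u \<cdot> y | u y. u \<in> U \<and> y \<in> W \<and> src u = rng y}"
proof -
  note UA = cob_Arr [OF U]
  \<comment> \<open>Here \<open>\<phi>\<close> picks by range instead: openness follows by writing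
    the translate as the preimage of \<open>W\<close> under the inverse translation.\<close>
  obtain \<phi> where \<phi>: "continuous_map (subtopology (unit_top G) (rng ` U)) (gtop G) \<phi>"
    "\<And>u. u \<in> U \<Longrightarrow> \<phi> (rng u) = u" 
    using U homeomorphic_map_section [of "gtop G" U "unit_top G" rng] cob_Arr [OF U]
    by (auto simp: compact_open_bisection_def open_bisection_def)
  have S: "openin (gtop G) {x \<in> Arr. rng x \<in> rng ` U}" (is "openin _ ?S")
    using U open_map_rng by (intro openin_rng_vimage) (auto simp: cob_iff open_map_def openin_unit_top)
  let ?X = "subtopology (gtop G) ?S"
  have "continuous_map ?X (subtopology (unit_top G) (rng ` U)) rng"
    by (auto simp: continuous_map_in_subtopology continuous_map_from_subtopology continuous_rng)
  from continuous_map_compose [OF continuous_map_compose [OF this \<phi>(1)] continuous_inv]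
  have "continuous_map ?X (gtop G) (\<lambda>x. ginverse (\<phi> (rng x)))" by (simp add: o_def)
  then have "continuous_map ?X (gtop G) (\<lambda>x. ginverse (\<phi> (rng x)) \<cdot> x)"
    by (rule continuous_map_mult) (use UA in \<open>auto simp: continuous_map_from_subtopology \<phi>(2)\<close>)
  from openin_continuous_map_preimage [OF this W]
  have "openin (gtop G) {x \<in> ?S. ginverse (\<phi> (rng x)) \<cdot> x \<in> W}"
    using S by (simp add: openin_open_subtopology Int_absorb1)
  also have "{x \<in> ?S. ginverse (\<phi> (rng x)) \<cdot> x \<in> W} = {u \<cdot> y | u y. u \<in> U \<and> y \<in> W \<and> src u = rng y}"
  proof (intro Set.set_eqI iffI)
    fix x assume x: "x \<in> {x \<in> ?S. ginverse (\<phi> (rng x)) \<cdot> x \<in> W}"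
    then obtain u where u: "u \<in> U" "rng u = rng x" by force
    then have "ginverse u \<cdot> x \<in> W" "x = u \<cdot> (ginverse u \<cdot> x)" "src u = rng (ginverse u \<cdot> x)"
      using \<phi>(2) [of u] x UA by auto
    then show "x \<in> {u \<cdot> y | u y. u \<in> U \<and> y \<in> W \<and> src u = rng y}" using u by blast
  next
    fix x assume "x \<in> {u \<cdot> y | u y. u \<in> U \<and> y \<in> W \<and> src u = rng y}"
    then obtain u y where "u \<in> U" "y \<in> W" "src u = rng y" "x = u \<cdot> y" by auto
    then show "x \<in> {x \<in> ?S. ginverse (\<phi> (rng x)) \<cdot> x \<in> W}"
      using UA openin_Arr [OF W] \<phi>(2) by (auto simp: subset_iff)
  qed
  finally show ?thesis .
qed

end

section \<open>Locally constant functions and convolution\<close>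

locale steinberg_setting = ample_groupoid G + K: field K
  for G :: "('g, 'x) tgroupoid_scheme" and K :: "('k, 'm) ring_scheme" (structure) +
  assumes hausdorff: "Hausdorff_space (gtop G)"
    and compact_units: "compact_space (unit_top G)"
begin

abbreviation S where "S \<equiv> steinberg_span K G"
abbreviation conv where "conv \<equiv> convolution K G"
abbreviation ind where "ind \<equiv> char_fun K"

lemma compactin_closed: "compactin (gtop G) C \<Longrightarrow> closedin (gtop G) C"
  by (rule compactin_imp_closedin [OF hausdorff])

lemma compactin_units: "compactin (gtop G) (gunits G)"
  using compact_units by (simp add: compact_space_def compactin_unit_top)

lemma cob_gunits: "compact_open_bisection G (gunits G)"
  by (simp add: cob_units openin_gtop_units compactin_units)

lemma openin_Diff_compact:
  "\<lbrakk>openin (gtop G) W; compactin (gtop G) C\<rbrakk> \<Longrightarrow> openin (gtop G) (W - C)"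
  by (simp add: compactin_closed openin_diff)

text \<open>Only nonzero levels are required to be open; the zero level follows from compactness of
  the support. As the support is taken in the whole ambient type, compactness also forces
  \<open>f\<close> to vanish off the arrows.\<close>

definition loc_const :: "('g \<Rightarrow> 'k) \<Rightarrow> bool" where
  "loc_const f \<longleftrightarrow> (\<forall>a. f a \<in> carrier K) \<and> compactin (gtop G) {a. f a \<noteq> \<zero>} \<and>
     (\<forall>k. k \<noteq> \<zero> \<longrightarrow> openin (gtop G) {a. f a = k})"

lemma loc_const_carrier: "loc_const f \<Longrightarrow> f a \<in> carrier K"
  by (simp add: loc_const_def)

lemma loc_const_Arr: "\<lbrakk>loc_const f; f a \<noteq> \<zero>\<rbrakk> \<Longrightarrow> a \<in> Arr"
  using compactin_subset_topspace by (fastforce simp: loc_const_def)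

text \<open>Every such set is a union of level sets. The zero level is open among the arrows because
  the support is compact, hence closed in a Hausdorff space.\<close>

lemma loc_const_open:
  assumes "loc_const f"
  shows "openin (gtop G) {a \<in> Arr. P (f a)}"
proof -
  have lev: "openin (gtop G) {a \<in> Arr. f a = k}" for k
  proof (cases "k = \<zero>")
    case True
    have "openin (gtop G) (Arr - {a. f a \<noteq> \<zero>})"
      using assms openin_topspace [of "gtop G"] by (intro openin_Diff_compact) (auto simp: loc_const_def)
    also have "Arr - {a. f a \<noteq> \<zero>} = {a \<in> Arr. f a = k}" using True by auto
    finally show ?thesis .
  next
    case False
    then have "{a \<in> Arr. f a = k} = {a. f a = k}" using loc_const_Arr [OF assms] by blast
    then show ?thesis using assms False by (simp add: loc_const_def)
  qed
  have "{a \<in> Arr. P (f a)} = (\<Union>k\<in>Collect P. {a \<in> Arr. f a = k})" by auto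
  then show ?thesis using lev by auto
qed

lemma loc_const_open2:
  assumes "loc_const f" "loc_const h"
  shows "openin (gtop G) {a \<in> Arr. P (f a) (h a)}"
proof -
  have "{a \<in> Arr. P (f a) (h a)} = (\<Union>k. {a \<in> Arr. f a = k} \<inter> {a \<in> Arr. P k (h a)})" by auto
  moreover have "openin (gtop G) ({a \<in> Arr. f a = k} \<inter> {a \<in> Arr. P k (h a)})" for k
    by (intro openin_Int loc_const_open assms)
  ultimately show ?thesis by auto
qed

text \<open>The zero level is open, so the support is closed, and compact as a closed subset of
  \<open>C\<close>. It thus suffices to name some compact set containing the support.\<close>

lemma loc_constI:
  assumes f: "\<And>a. f a \<in> carrier K" "\<And>a. f a \<noteq> \<zero> \<Longrightarrow> a \<in> C"
    and C: "compactin (gtop G) C"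
    and lev: "\<And>k. openin (gtop G) {a \<in> Arr. f a = k}"
  shows "loc_const f"
proof -
  have CA: "C \<subseteq> Arr" using compactin_subset_topspace [OF C] by simp
  have "Arr - {a \<in> Arr. f a = \<zero>} = {a. f a \<noteq> \<zero>}" using f CA by auto
  moreover have "closedin (gtop G) (Arr - {a \<in> Arr. f a = \<zero>})"
    using lev closedin_diff [OF closedin_topspace] by force
  ultimately have "compactin (gtop G) {a. f a \<noteq> \<zero>}"
    using closed_compactin [OF C] f(2) by auto
  moreover have "openin (gtop G) {a. f a = k}" if "k \<noteq> \<zero>" for k
  proof -
    have "{a \<in> Arr. f a = k} = {a. f a = k}" using f CA that by auto
    then show ?thesis using lev [of k] by simp
  qed
  ultimately show ?thesis using f by (simp add: loc_const_def)
qed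

lemma loc_const_zero: "loc_const (\<lambda>a. \<zero>)"
proof (rule loc_constI [of _ "{}"])
  fix k show "openin (gtop G) {a \<in> Arr. \<zero> = k}"
    using openin_topspace [of "gtop G"] by (cases "\<zero> = k") auto
qed auto

lemma loc_const_ind:
  assumes "openin (gtop G) U" "compactin (gtop G) U"
  shows "loc_const (ind U)"
proof (rule loc_constI [OF _ _ assms(2)])
  fix k
  have "{a \<in> Arr. ind U a = k} = (if k = \<one> then U else {}) \<union> (if k = \<zero> then Arr - U else {})"
    using openin_Arr [OF assms(1)] by (auto simp: char_fun_def)
  then show "openin (gtop G) {a \<in> Arr. ind U a = k}"
    using assms openin_Diff_compact [OF openin_topspace assms(2)] by auto
qed (auto simp: char_fun_def split: if_splits)

lemma loc_const_add:
  assumes "loc_const f" "loc_const h"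
  shows "loc_const (\<lambda>a. f a \<oplus> h a)"
proof (rule loc_constI [of _ "{a. f a \<noteq> \<zero>} \<union> {a. h a \<noteq> \<zero>}"])
  show "compactin (gtop G) ({a. f a \<noteq> \<zero>} \<union> {a. h a \<noteq> \<zero>})"
    using assms by (simp add: loc_const_def compactin_Un)
qed (use assms in \<open>auto simp: loc_const_carrier intro: loc_const_open2\<close>)

lemma loc_const_scale:
  assumes "loc_const f" "k \<in> carrier K"
  shows "loc_const (\<lambda>a. k \<otimes> f a)"
proof (rule loc_constI [of _ "{a. f a \<noteq> \<zero>}"])
  show "compactin (gtop G) {a. f a \<noteq> \<zero>}"
    using assms by (simp add: loc_const_def)
qed (use assms in \<open>auto simp: loc_const_carrier intro: loc_const_open\<close>)

lemma loc_const_restrict: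
  assumes f: "loc_const f" and C: "openin (gtop G) C" "closedin (gtop G) C"
  shows "loc_const (\<lambda>a. if a \<in> C then f a else \<zero>)"
proof (rule loc_constI [of _ "{a. f a \<noteq> \<zero>}"])
  show "compactin (gtop G) {a. f a \<noteq> \<zero>}"
    using f by (simp add: loc_const_def)
  fix k
  have "{a \<in> Arr. (if a \<in> C then f a else \<zero>) = k} =
      (C \<inter> {a \<in> Arr. f a = k}) \<union> (if k = \<zero> then Arr - C else {})"
    using openin_Arr [OF C(1)] by auto
  then show "openin (gtop G) {a \<in> Arr. (if a \<in> C then f a else \<zero>) = k}"
    using openin_Int [OF C(1) loc_const_open [OF f, of "\<lambda>v. v = k"]]
      openin_diff [OF openin_topspace C(2)] by auto
qed (use f in \<open>auto simp: loc_const_carrier split: if_splits\<close>)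

lemma span_imp_loc_const: "f \<in> S \<Longrightarrow> loc_const f"
  by (induction rule: steinberg_span.induct)
    (auto simp: loc_const_zero loc_const_ind loc_const_add loc_const_scale cob_iff)

text \<open>
  Peeling off one bisection at a time spoils constancy on the remaining ones, but keeps \<open>f\<close>
  two-valued there, with one of the values zero.
\<close>

lemma loc_const_cover_span:
  assumes "finite F" "loc_const f" "{a. f a \<noteq> \<zero>} \<subseteq> \<Union>F"
    and "\<And>B. B \<in> F \<Longrightarrow> compact_open_bisection G B \<and> (\<exists>k. \<forall>a\<in>B. f a = \<zero> \<or> f a = k)"
  shows "f \<in> S"
  using assms
proof (induction F arbitrary: f rule: finite_induct)
  case empty
  then have "f = (\<lambda>a. \<zero>)" by auto
  then show ?case by (simp add: steinberg_span.zero)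
next
  case (insert B F)
  obtain k where k: "\<forall>a\<in>B. f a = \<zero> \<or> f a = k" 
    using insert.prems(3) [of B] by auto
  have B: "compact_open_bisection G B" using insert.prems(3) [of B] by simp
  then have cl: "closedin (gtop G) B" "openin (gtop G) B"
    by (auto simp: cob_iff compactin_closed)
  let ?f = "\<lambda>a. if a \<in> Arr - B then f a else \<zero>"
  \<comment> \<open>On \<open>?V\<close> the function is constantly \<open>k\<close>, so
    \<open>f\<close> splits into \<open>k\<close> times the indicator of \<open>?V\<close> and its
    restriction off \<open>B\<close>.\<close>
  let ?V = "{a \<in> Arr. f a \<noteq> \<zero>} \<inter> B"
  have "loc_const ?f"
    using cl by (intro loc_const_restrict insert.prems) (auto simp: openin_diff closedin_diff)
  then have f: "?f \<in> S"
  proof (rule insert.IH)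
    show "{a. ?f a \<noteq> \<zero>} \<subseteq> \<Union>F" using insert.prems(2) by auto
    fix B' assume "B' \<in> F"
    then have "compact_open_bisection G B'" "\<exists>k. \<forall>a\<in>B'. f a = \<zero> \<or> f a = k"
      using insert.prems(3) [of B'] by auto
    then show "compact_open_bisection G B' \<and> (\<exists>k. \<forall>a\<in>B'. ?f a = \<zero> \<or> ?f a = k)" by auto
  qed
  have supp: "{a \<in> Arr. f a \<noteq> \<zero>} = {a. f a \<noteq> \<zero>}"
    using loc_const_Arr [OF insert.prems(1)] by auto
  have V: "compact_open_bisection G ?V"
    using B loc_const_open [OF insert.prems(1), of "\<lambda>v. v \<noteq> \<zero>"] insert.prems(1) cl
    by (intro cob_subset [OF B]) (auto simp: supp loc_const_def compact_Int_closedin)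
  show ?case
  \<comment> \<open>If \<open>?V\<close> is empty, \<open>k\<close> need not be a value of
    \<open>f\<close>, and nothing places it in \<open>carrier K\<close>.\<close>
  proof (cases "?V = {}")
    case True
    then have "f = ?f" using supp by fastforce
    then show ?thesis using f by simp
  next
    case False
    then have kc: "k \<in> carrier K" using k loc_const_carrier [OF insert.prems(1)] by blast
    have "f = (\<lambda>a. k \<otimes> ind ?V a \<oplus> ?f a)"
    proof
      fix a show "f a = k \<otimes> ind ?V a \<oplus> ?f a"
        using k kc loc_const_carrier [OF insert.prems(1), of a] loc_const_Arr [OF insert.prems(1), of a]
        by (auto simp: char_fun_def)
    qed
    moreover have "(\<lambda>a. k \<otimes> ind ?V a \<oplus> ?f a) \<in> S"
      by (intro steinberg_span.intros V kc f)
    ultimately show ?thesis by simp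
  qed
qed

text \<open>Around each point of the support some bisection carries a constant value. Compactness
  leaves finitely many, possibly overlapping, and \<open>loc_const_cover_span\<close> peels them
  off.\<close>

lemma loc_const_imp_span:
  assumes f: "loc_const f"
  shows "f \<in> S"
proof -
  let ?B = "{B. compact_open_bisection G B \<and> (\<exists>k. \<forall>a\<in>B. f a = k)}"
  have "\<exists>B. B \<in> ?B \<and> a \<in> B" if "f a \<noteq> \<zero>" for a
  proof -
    have "openin (gtop G) {b. f b = f a}" using f that by (simp add: loc_const_def)
    then obtain B where "compact_open_bisection G B" "a \<in> B" "B \<subseteq> {b. f b = f a}"
      using ex_cob [of "{b. f b = f a}" a] by blast
    then show ?thesis by blast
  qed
  then have "{a. f a \<noteq> \<zero>} \<subseteq> \<Union>?B" by blast
  moreover have "\<forall>B\<in>?B. openin (gtop G) B" by (simp add: cob_iff)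
  moreover have "compactin (gtop G) {a. f a \<noteq> \<zero>}" using f by (simp add: loc_const_def)
  ultimately obtain F where F: "finite F" "F \<subseteq> ?B" "{a. f a \<noteq> \<zero>} \<subseteq> \<Union>F"
    unfolding compactin_def by meson
  show ?thesis
    by (rule loc_const_cover_span [OF F(1) f F(3)]) (use F(2) in blast)
qed

lemma span_iff: "f \<in> S \<longleftrightarrow> loc_const f"
  using span_imp_loc_const loc_const_imp_span by blast

lemma span_carrier [simp]: "f \<in> S \<Longrightarrow> f a \<in> carrier K"
  by (simp add: span_iff loc_const_carrier)

lemma span_Arr: "\<lbrakk>f \<in> S; f a \<noteq> \<zero>\<rbrakk> \<Longrightarrow> a \<in> Arr"
  by (simp add: span_iff loc_const_Arr)

lemma ind_span [simp]: "compact_open_bisection G U \<Longrightarrow> ind U \<in> S"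
  by (rule steinberg_span.char_fun)

text \<open>A bisection meets a fibre of \<open>rng\<close> in at most one arrow, and sums and
  multiples keep this finite. All convolution sums are finite for this reason.\<close>

lemma finite_fibre:
  assumes "f \<in> S"
  shows "finite {a \<in> Arr. rng a = v \<and> f a \<noteq> \<zero>}"
  using assms
proof (induction rule: steinberg_span.induct)
  case (char_fun U)
  let ?A = "{a \<in> Arr. rng a = v \<and> ind U a \<noteq> \<zero>}"
  have "?A \<subseteq> U" by (auto simp: char_fun_def)
  then have "inj_on rng ?A" using char_fun inj_on_subset by (auto simp: cob_iff)
  moreover have "finite (rng ` ?A)" by (rule finite_subset [of _ "{v}"]) auto
  ultimately show ?case by (rule finite_imageD [rotated])
next
  case (add f h)
  then have "finite ({a \<in> Arr. rng a = v \<and> f a \<noteq> \<zero>} \<union> {a \<in> Arr. rng a = v \<and> h a \<noteq> \<zero>})" by simp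
  then show ?case by (rule rev_finite_subset) auto
next
  case (scale k f)
  show ?case by (rule finite_subset [OF _ scale.IH]) (use scale in auto)
qed simp

section \<open>Convolution at an arrow as a finite sum\<close>

lemma conv_outside: "x \<notin> Arr \<Longrightarrow> conv f h x = \<zero>"
proof -
  assume "x \<notin> Arr"
  then have "{(a, b) \<in> composable G. a \<cdot> b = x \<and> f a \<noteq> \<zero> \<and> h b \<noteq> \<zero>} = {}"
    using mult_closed by auto
  then show ?thesis by (simp only: convolution_def K.finsum_empty)
qed

text \<open>A factorisation of \<open>x\<close> is determined by its left factor \<open>a\<close>,
  the right one being \<open>ginverse a \<cdot> x\<close>. The index set may be any finite part of
  the fibre that contains all contributing left factors, which allows different convolutions to be
  compared over a common set.\<close>

lemma conv_eq_sum:
  assumes vals: "\<And>a. f a \<in> carrier K" "\<And>a. h a \<in> carrier K" and x: "x \<in> Arr"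
    and A: "finite A" "A \<subseteq> {a \<in> Arr. rng a = rng x}"
      "\<And>a. \<lbrakk>a \<in> Arr; rng a = rng x; f a \<noteq> \<zero>; h (ginverse a \<cdot> x) \<noteq> \<zero>\<rbrakk> \<Longrightarrow> a \<in> A"
  shows "conv f h x = (\<Oplus>a\<in>A. f a \<otimes> h (ginverse a \<cdot> x))"
proof -
  let ?T = "{a \<in> A. f a \<noteq> \<zero> \<and> h (ginverse a \<cdot> x) \<noteq> \<zero>}"
  let ?p = "\<lambda>a. (a, ginverse a \<cdot> x)"
  have "{(a, b) \<in> composable G. a \<cdot> b = x \<and> f a \<noteq> \<zero> \<and> h b \<noteq> \<zero>} = ?p ` ?T"
  proof (intro Set.set_eqI iffI)
    fix p assume "p \<in> {(a, b) \<in> composable G. a \<cdot> b = x \<and> f a \<noteq> \<zero> \<and> h b \<noteq> \<zero>}"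
    then obtain a b where p: "p = (a, b)" "a \<in> Arr" "b \<in> Arr" "src a = rng b" "a \<cdot> b = x"
      "f a \<noteq> \<zero>" "h b \<noteq> \<zero>" by (auto simp: composable_def)
    then have "b = ginverse a \<cdot> x" "rng a = rng x" by auto
    then show "p \<in> ?p ` ?T" using p A(3) [of a] by auto
  next
    fix p assume "p \<in> ?p ` ?T"
    then show "p \<in> {(a, b) \<in> composable G. a \<cdot> b = x \<and> f a \<noteq> \<zero> \<and> h b \<noteq> \<zero>}"
      using A(2) x by (auto simp: composable_def)
  qed
  then have "conv f h x = (\<Oplus>p\<in>?p ` ?T. (\<lambda>(a, b). f a \<otimes> h b) p)"
    by (simp only: convolution_def)
  also have "\<dots> = (\<Oplus>a\<in>?T. (\<lambda>(a, b). f a \<otimes> h b) (?p a))"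
    by (rule K.finsum_reindex) (auto simp: vals inj_on_def)
  also have "\<dots> = (\<Oplus>a\<in>A. f a \<otimes> h (ginverse a \<cdot> x))"
    by (rule K.add.finprod_mono_neutral_cong_left) (use vals A(1) in auto)
  finally show ?thesis .
qed

lemma conv_eq_fibre_sum:
  assumes "f \<in> S" "h \<in> S" "x \<in> Arr"
  shows "conv f h x = (\<Oplus>a\<in>{a \<in> Arr. rng a = rng x \<and> f a \<noteq> \<zero>}. f a \<otimes> h (ginverse a \<cdot> x))"
  by (rule conv_eq_sum) (use assms finite_fibre in auto)

lemma conv_nonzeroE:
  assumes "f \<in> S" "h \<in> S" "conv f h x \<noteq> \<zero>"
  obtains a b where "a \<in> Arr" "b \<in> Arr" "src a = rng b" "x = a \<cdot> b" "f a \<noteq> \<zero>" "h b \<noteq> \<zero>"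
proof (rule ccontr)
  assume "\<not> thesis"
  then have "{(a, b) \<in> composable G. a \<cdot> b = x \<and> f a \<noteq> \<zero> \<and> h b \<noteq> \<zero>} = {}"
    using that by (auto simp: composable_def)
  then have "conv f h x = \<zero>" by (simp only: convolution_def K.finsum_empty)
  then show False using assms(3) by simp
qed

lemma conv_add_left:
  assumes "f \<in> S" "g \<in> S" "h \<in> S"
  shows "conv (\<lambda>a. f a \<oplus> g a) h = (\<lambda>x. conv f h x \<oplus> conv g h x)"
proof
  fix x
  show "conv (\<lambda>a. f a \<oplus> g a) h x = conv f h x \<oplus> conv g h x"
  proof (cases "x \<in> Arr")
    case True
    \<comment> \<open>The supports of \<open>f\<close>, \<open>g\<close> and their sum may differ;
      all three convolutions are expanded over this union.\<close>
    let ?A = "{a \<in> Arr. rng a = rng x \<and> f a \<noteq> \<zero>} \<union> {a \<in> Arr. rng a = rng x \<and> g a \<noteq> \<zero>}"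
    have fin: "finite ?A" using assms finite_fibre by simp
    have "conv (\<lambda>a. f a \<oplus> g a) h x = (\<Oplus>a\<in>?A. (f a \<oplus> g a) \<otimes> h (ginverse a \<cdot> x))"
      by (rule conv_eq_sum) (use assms True fin in auto)
    also have "\<dots> = (\<Oplus>a\<in>?A. f a \<otimes> h (ginverse a \<cdot> x) \<oplus> g a \<otimes> h (ginverse a \<cdot> x))"
      by (rule K.finsum_cong') (use assms in \<open>auto simp: K.l_distr\<close>)
    also have "\<dots> = (\<Oplus>a\<in>?A. f a \<otimes> h (ginverse a \<cdot> x)) \<oplus> (\<Oplus>a\<in>?A. g a \<otimes> h (ginverse a \<cdot> x))"
      by (rule K.finsum_addf) (use assms in auto)
    also have "(\<Oplus>a\<in>?A. f a \<otimes> h (ginverse a \<cdot> x)) = conv f h x"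
      by (rule conv_eq_sum [symmetric]) (use assms True fin in auto)
    also have "(\<Oplus>a\<in>?A. g a \<otimes> h (ginverse a \<cdot> x)) = conv g h x"
      by (rule conv_eq_sum [symmetric]) (use assms True fin in auto)
    finally show ?thesis .
  qed (simp add: conv_outside)
qed

lemma conv_add_right:
  assumes "f \<in> S" "g \<in> S" "h \<in> S"
  shows "conv f (\<lambda>a. g a \<oplus> h a) = (\<lambda>x. conv f g x \<oplus> conv f h x)"
proof
  fix x
  show "conv f (\<lambda>a. g a \<oplus> h a) x = conv f g x \<oplus> conv f h x"
  proof (cases "x \<in> Arr")
    case True
    let ?A = "{a \<in> Arr. rng a = rng x \<and> f a \<noteq> \<zero>}"
    have "conv f (\<lambda>a. g a \<oplus> h a) x = (\<Oplus>a\<in>?A. f a \<otimes> (g (ginverse a \<cdot> x) \<oplus> h (ginverse a \<cdot> x)))"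
      using conv_eq_fibre_sum [OF assms(1) steinberg_span.add [OF assms(2,3)] True] .
    also have "\<dots> = (\<Oplus>a\<in>?A. f a \<otimes> g (ginverse a \<cdot> x) \<oplus> f a \<otimes> h (ginverse a \<cdot> x))"
      by (rule K.finsum_cong') (use assms in \<open>auto simp: K.r_distr\<close>)
    also have "\<dots> = (\<Oplus>a\<in>?A. f a \<otimes> g (ginverse a \<cdot> x)) \<oplus> (\<Oplus>a\<in>?A. f a \<otimes> h (ginverse a \<cdot> x))"
      by (rule K.finsum_addf) (use assms in auto)
    finally show ?thesis using assms True by (simp add: conv_eq_fibre_sum)
  qed (simp add: conv_outside)
qed

lemma conv_carrier:
  assumes "f \<in> S" "h \<in> S"
  shows "conv f h x \<in> carrier K"
  using assms by (auto simp: convolution_def intro!: K.finsum_closed)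

lemma conv_scale_left:
  assumes "f \<in> S" "h \<in> S" "k \<in> carrier K"
  shows "conv (\<lambda>a. k \<otimes> f a) h = (\<lambda>x. k \<otimes> conv f h x)"
proof
  fix x
  show "conv (\<lambda>a. k \<otimes> f a) h x = k \<otimes> conv f h x"
  proof (cases "x \<in> Arr")
    case True
    let ?A = "{a \<in> Arr. rng a = rng x \<and> f a \<noteq> \<zero>}"
    have fin: "finite ?A" using assms finite_fibre by simp
    have "conv (\<lambda>a. k \<otimes> f a) h x = (\<Oplus>a\<in>?A. (k \<otimes> f a) \<otimes> h (ginverse a \<cdot> x))"
      by (rule conv_eq_sum) (use assms True fin in auto)
    also have "\<dots> = (\<Oplus>a\<in>?A. k \<otimes> (f a \<otimes> h (ginverse a \<cdot> x)))"
      by (rule K.finsum_cong') (use assms in \<open>auto simp: K.m_assoc\<close>)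
    also have "\<dots> = k \<otimes> (\<Oplus>a\<in>?A. f a \<otimes> h (ginverse a \<cdot> x))"
      by (rule K.finsum_rdistr [symmetric]) (use assms fin in auto)
    finally show ?thesis using assms True by (simp add: conv_eq_fibre_sum)
  qed (use assms in \<open>simp add: conv_outside\<close>)
qed

lemma conv_zero_left: "conv (\<lambda>a. \<zero>) h = (\<lambda>x. \<zero>)"
  by (simp add: convolution_def)

text \<open>Injectivity of \<open>rng\<close> on \<open>U\<close> leaves \<open>u\<close> as the
  only left factor, so convolution with an indicator is a translation.\<close>

lemma conv_ind_left:
  assumes "compact_open_bisection G U" "h \<in> S" "x \<in> Arr" "u \<in> U" "rng u = rng x"
  shows "conv (ind U) h x = h (ginverse u \<cdot> x)"
proof -
  have inj: "inj_on rng U" using assms(1) by (simp add: cob_iff)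
  have u: "u \<in> Arr" using assms(1,4) cob_Arr by blast
  have "conv (ind U) h x = (\<Oplus>a\<in>{u}. ind U a \<otimes> h (ginverse a \<cdot> x))"
  proof (rule conv_eq_sum)
    fix a assume a: "rng a = rng x" "ind U a \<noteq> \<zero>"
    then have "a \<in> U" by (auto simp: char_fun_def split: if_splits)
    then have "a = u" using inj_onD [OF inj, of a u] a(1) assms(4,5) by simp
    then show "a \<in> {u}" by simp
  qed (use assms u in auto)
  then show ?thesis using assms(2,4) by (simp add: char_fun_def)
qed

lemma conv_ind_left_zero:
  assumes "compact_open_bisection G U" "h \<in> S" "rng x \<notin> rng ` U"
  shows "conv (ind U) h x = \<zero>"
proof (rule ccontr)
  assume "conv (ind U) h x \<noteq> \<zero>"
  then obtain a b where "a \<in> Arr" "b \<in> Arr" "src a = rng b" "x = a \<cdot> b" "ind U a \<noteq> \<zero>"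
    using conv_nonzeroE [OF ind_span [OF assms(1)] assms(2)] by metis
  then show False using assms(3) by (auto simp: char_fun_def split: if_splits)
qed

lemma conv_ind_right:
  assumes "compact_open_bisection G U" "h \<in> S" "x \<in> Arr" "u \<in> U" "src u = src x"
  shows "conv h (ind U) x = h (x \<cdot> ginverse u)"
proof -
  have inj: "inj_on src U" using assms(1) by (simp add: cob_iff)
  have u: "u \<in> Arr" using assms(1,4) cob_Arr by blast
  \<comment> \<open>The right factor lies in \<open>U\<close> and has the source of
    \<open>x\<close>, hence is \<open>u\<close>; this fixes the left factor.\<close>
  have "conv h (ind U) x = (\<Oplus>a\<in>{x \<cdot> ginverse u}. h a \<otimes> ind U (ginverse a \<cdot> x))"
  proof (rule conv_eq_sum)
    fix a assume a: "a \<in> Arr" "rng a = rng x" "ind U (ginverse a \<cdot> x) \<noteq> \<zero>"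
    then have "ginverse a \<cdot> x \<in> U" by (auto simp: char_fun_def split: if_splits)
    moreover have "src (ginverse a \<cdot> x) = src u" using a assms by simp
    ultimately have "u = ginverse a \<cdot> x" using inj_onD [OF inj] assms(4) by metis
    then show "a \<in> {x \<cdot> ginverse u}" using a assms(3) by (simp add: inv_mult)
  qed (use assms u in auto)
  also have "ginverse (x \<cdot> ginverse u) \<cdot> x = u"
    using assms u by (simp add: inv_mult assoc inv_mult_self) (metis mult_src)
  then have "(\<Oplus>a\<in>{x \<cdot> ginverse u}. h a \<otimes> ind U (ginverse a \<cdot> x)) = h (x \<cdot> ginverse u)"
    using assms(2,4) by (simp add: char_fun_def)
  finally show ?thesis .
qed

lemma conv_ind_right_zero:
  assumes "compact_open_bisection G U" "h \<in> S" "src x \<notin> src ` U"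
  shows "conv h (ind U) x = \<zero>"
proof (rule ccontr)
  assume "conv h (ind U) x \<noteq> \<zero>"
  then obtain a b where "a \<in> Arr" "b \<in> Arr" "src a = rng b" "x = a \<cdot> b" "ind U b \<noteq> \<zero>"
    using conv_nonzeroE [OF assms(2) ind_span [OF assms(1)]] by metis
  then show False using assms(3) by (auto simp: char_fun_def split: if_splits)
qed

text \<open>Translation by a unit is trivial, so such an indicator acts on the left by restricting
  the range and, in \<open>conv_unit_ind_right\<close>, on the right by restricting the source.
  Elements of ideals are cut down with this pair.\<close>

lemma conv_unit_ind_left:
  assumes "compact_open_bisection G W" "W \<subseteq> gunits G" "h \<in> S"
  shows "conv (ind W) h x = (if x \<in> Arr \<and> rng x \<in> W then h x else \<zero>)"
proof -
  have "rng ` W = W" using assms(2) unit_simps by (metis image_cong image_ident subset_iff)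
  moreover have "conv (ind W) h x = h x" if "x \<in> Arr" "rng x \<in> W"
    using conv_ind_left [OF assms(1,3) that(1), of "rng x"] that by simp
  ultimately show ?thesis using conv_outside conv_ind_left_zero [OF assms(1,3)] by auto
qed

lemma conv_unit_ind_right:
  assumes "compact_open_bisection G W" "W \<subseteq> gunits G" "h \<in> S"
  shows "conv h (ind W) x = (if x \<in> Arr \<and> src x \<in> W then h x else \<zero>)"
proof -
  have "src ` W = W" using assms(2) unit_simps by (metis image_cong image_ident subset_iff)
  moreover have "conv h (ind W) x = h x" if "x \<in> Arr" "src x \<in> W"
    using conv_ind_right [OF assms(1,3) that(1), of "src x"] that by simp
  ultimately show ?thesis using conv_outside conv_ind_right_zero [OF assms(1,3)] by auto
qed

text \<open>For \<open>P\<close> either "nonzero" or "equal to a given nonzero value", this presents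
  support and levels of the product as translates, ready for \<open>translation_compact\<close> and
  \<open>translation_open\<close>. The product vanishes where no \<open>u\<close> is available, so
  \<open>P\<close> must fail at \<open>\<zero>\<close>.\<close>

lemma conv_ind_left_level:
  assumes U: "compact_open_bisection G U" and h: "h \<in> S" and P: "\<not> P \<zero>"
  shows "{x. P (conv (ind U) h x)} = {u \<cdot> y | u y. u \<in> U \<and> y \<in> {y \<in> Arr. P (h y)} \<and> src u = rng y}"
proof (intro Set.set_eqI iffI)
  fix x assume "x \<in> {x. P (conv (ind U) h x)}"
  then have x: "P (conv (ind U) h x)" by simp
  then have xA: "x \<in> Arr" using conv_outside P by metis
  obtain u where u: "u \<in> U" "rng u = rng x"
    using x P conv_ind_left_zero [OF U h] by (metis imageE)
  then have uA: "u \<in> Arr" using cob_Arr U by blast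
  have "P (h (ginverse u \<cdot> x))" using x conv_ind_left [OF U h xA u] by simp
  moreover have "x = u \<cdot> (ginverse u \<cdot> x)" "ginverse u \<cdot> x \<in> Arr" "src u = rng (ginverse u \<cdot> x)"
    using u uA xA by auto
  ultimately show "x \<in> {u \<cdot> y | u y. u \<in> U \<and> y \<in> {y \<in> Arr. P (h y)} \<and> src u = rng y}"
    using u by blast
next
  fix x assume "x \<in> {u \<cdot> y | u y. u \<in> U \<and> y \<in> {y \<in> Arr. P (h y)} \<and> src u = rng y}"
  then obtain u y where x: "x = u \<cdot> y" "u \<in> U" "y \<in> Arr" "P (h y)" "src u = rng y" by blast
  then have "u \<in> Arr" using cob_Arr U by blast
  then show "x \<in> {x. P (conv (ind U) h x)}" using x conv_ind_left [OF U h, of x u] by simp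
qed

lemma conv_ind_left_span:
  assumes U: "compact_open_bisection G U" and h: "h \<in> S"
  shows "conv (ind U) h \<in> S"
proof -
  have lc: "loc_const h" using h by (simp add: span_iff)
  have sU: "openin (gtop G) (src ` U)" "compactin (gtop G) (src ` U)"
    using U open_map_src image_compactin [OF _ continuous_src]
    by (auto simp: cob_iff open_map_def openin_unit_top compactin_unit_top)
  \<comment> \<open>\<open>translation_compact\<close> wants all ranges among the sources of
    \<open>U\<close>. As \<open>?D\<close> is clopen, the part of the support inside it is still
    compact.\<close>
  let ?D = "{y \<in> Arr. rng y \<in> src ` U}"
  have D: "openin (gtop G) ?D" by (rule openin_rng_vimage [OF sU(1)])
  have "Arr - {y \<in> Arr. rng y \<in> Arr - src ` U} = ?D" by auto
  moreover have "openin (gtop G) {y \<in> Arr. rng y \<in> Arr - src ` U}"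
    using openin_Diff_compact [OF openin_topspace sU(2)] by (intro openin_rng_vimage) simp
  ultimately have D': "closedin (gtop G) ?D"
    using closedin_diff [OF closedin_topspace] by fastforce
  let ?C = "{y. h y \<noteq> \<zero>} \<inter> ?D"
  have "compactin (gtop G) ?C" using lc D' by (simp add: loc_const_def compact_Int_closedin)
  then have "compactin (gtop G) {u \<cdot> y | u y. u \<in> U \<and> y \<in> ?C \<and> src u = rng y}"
    by (rule translation_compact [OF U]) auto
  also have "{u \<cdot> y | u y. u \<in> U \<and> y \<in> ?C \<and> src u = rng y} =
     {u \<cdot> y | u y. u \<in> U \<and> y \<in> {y \<in> Arr. h y \<noteq> \<zero>} \<and> src u = rng y}" by force
  also have "\<dots> = {x. conv (ind U) h x \<noteq> \<zero>}"
    by (rule conv_ind_left_level [OF U h, symmetric]) simp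
  finally have "compactin (gtop G) {x. conv (ind U) h x \<noteq> \<zero>}" .
  moreover have "openin (gtop G) {x. conv (ind U) h x = k}" if "k \<noteq> \<zero>" for k
    using translation_open [OF U loc_const_open [OF lc, of "\<lambda>v. v = k"]]
      conv_ind_left_level [OF U h, of "\<lambda>v. v = k"] that by simp
  ultimately have "loc_const (conv (ind U) h)"
    using U h by (simp add: loc_const_def conv_carrier)
  then show ?thesis by (simp add: span_iff)
qed

section \<open>Closure and associativity of convolution\<close>

lemma conv_span [simp]:
  assumes "f \<in> S" "h \<in> S"
  shows "conv f h \<in> S"
  using assms
proof (induction rule: steinberg_span.induct)
  case zero then show ?case by (simp add: conv_zero_left steinberg_span.zero)
next
  case (char_fun U) then show ?case by (simp add: conv_ind_left_span)
next
  case (add f g) then show ?case by (simp add: conv_add_left steinberg_span.add)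
next
  case (scale k f) then show ?case by (simp add: conv_scale_left steinberg_span.scale)
qed

text \<open>Both sides equal \<open>conv g h (ginverse u \<cdot> x)\<close> for the \<open>u\<close>
  in \<open>U\<close> with the range of \<open>x\<close>: multiplication by \<open>u\<close> carries
  left factors of \<open>ginverse u \<cdot> x\<close> to left factors of \<open>x\<close> and
  reindexes the sum. If there is no such \<open>u\<close>, both sides vanish.\<close>

lemma conv_ind_assoc:
  assumes U: "compact_open_bisection G U" and g: "g \<in> S" and h: "h \<in> S"
  shows "conv (conv (ind U) g) h = conv (ind U) (conv g h)"
proof
  fix x
  note UA = cob_Arr [OF U]
  show "conv (conv (ind U) g) h x = conv (ind U) (conv g h) x"
  proof (cases "x \<in> Arr \<and> rng x \<in> rng ` U")
    case False
    have "conv (conv (ind U) g) h x = \<zero>"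
    proof (rule ccontr)
      assume "conv (conv (ind U) g) h x \<noteq> \<zero>"
      then obtain a b where ab: "a \<in> Arr" "b \<in> Arr" "src a = rng b" "x = a \<cdot> b" "conv (ind U) g a \<noteq> \<zero>"
        using conv_nonzeroE [OF conv_span [OF ind_span [OF U] g] h] by metis
      then have "rng a \<in> rng ` U" using conv_ind_left_zero [OF U g] by blast
      then show False using False ab by simp
    qed
    moreover have "conv (ind U) (conv g h) x = \<zero>"
      using False conv_outside conv_ind_left_zero [OF U conv_span [OF g h]] by blast
    ultimately show ?thesis by simp
  next
    case True
    then obtain u where u: "u \<in> U" "rng u = rng x" "u \<in> Arr" using UA by force
    have x: "x \<in> Arr" using True by simp
    let ?A = "{a \<in> Arr. rng a = rng (ginverse u \<cdot> x) \<and> g a \<noteq> \<zero>}"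
    have A: "a \<in> Arr \<and> rng a = src u" if "a \<in> ?A" for a using that u x by auto
    have fin: "finite ?A" by (rule finite_fibre [OF g])
    have val: "conv (ind U) g (u \<cdot> a) = g a" if "a \<in> Arr" "rng a = src u" for a
      using conv_ind_left [OF U g _ u(1), of "u \<cdot> a"] that u by simp
    have "conv (conv (ind U) g) h x = (\<Oplus>a\<in>(\<lambda>a. u \<cdot> a) ` ?A. conv (ind U) g a \<otimes> h (ginverse a \<cdot> x))"
    proof (rule conv_eq_sum)
      fix a assume a: "a \<in> Arr" "rng a = rng x" "conv (ind U) g a \<noteq> \<zero>"
      then have "g (ginverse u \<cdot> a) \<noteq> \<zero>" using conv_ind_left [OF U g a(1) u(1)] u(2) by simp
      then have "ginverse u \<cdot> a \<in> ?A" using a u x by simp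
      moreover have "a = u \<cdot> (ginverse u \<cdot> a)" using a u by simp
      ultimately show "a \<in> (\<lambda>a. u \<cdot> a) ` ?A" by blast
    qed (use U g h x u fin in auto)
    also have "\<dots> = (\<Oplus>a\<in>?A. conv (ind U) g (u \<cdot> a) \<otimes> h (ginverse (u \<cdot> a) \<cdot> x))"
    proof (rule K.finsum_reindex)
      show "inj_on (\<lambda>a. u \<cdot> a) ?A"
      proof (rule inj_onI)
        fix a b assume ab: "a \<in> ?A" "b \<in> ?A" and eq: "u \<cdot> a = u \<cdot> b"
        have "a = ginverse u \<cdot> (u \<cdot> a)" using A [OF ab(1)] u(3) by simp
        also have "\<dots> = b" unfolding eq using A [OF ab(2)] u(3) by simp
        finally show "a = b" .
      qed
      show "(\<lambda>a. conv (ind U) g a \<otimes> h (ginverse a \<cdot> x)) \<in> (\<lambda>a. u \<cdot> a) ` ?A \<rightarrow> carrier K"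
        using U g h by (intro funcsetI) simp
    qed
    also have "\<dots> = (\<Oplus>a\<in>?A. g a \<otimes> h (ginverse a \<cdot> (ginverse u \<cdot> x)))"
    proof (rule K.finsum_cong')
      fix a assume "a \<in> ?A"
      then have a: "a \<in> Arr" "rng a = src u" using A by blast+
      have "ginverse (u \<cdot> a) \<cdot> x = ginverse a \<cdot> (ginverse u \<cdot> x)"
        using a u(2,3) x by (simp add: inv_mult assoc)
      then show "conv (ind U) g (u \<cdot> a) \<otimes> h (ginverse (u \<cdot> a) \<cdot> x) = g a \<otimes> h (ginverse a \<cdot> (ginverse u \<cdot> x))"
        using val [OF a] by simp
    next
      show "(\<lambda>a. g a \<otimes> h (ginverse a \<cdot> (ginverse u \<cdot> x))) \<in> ?A \<rightarrow> carrier K"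
        using g h by (intro funcsetI) simp
    qed (rule refl)
    also have "\<dots> = conv g h (ginverse u \<cdot> x)"
      using conv_eq_fibre_sum [OF g h, of "ginverse u \<cdot> x"] u x by simp
    also have "\<dots> = conv (ind U) (conv g h) x"
      using conv_ind_left [OF U conv_span [OF g h] x u(1,2)] by simp
    finally show ?thesis .
  qed
qed

lemma conv_assoc:
  assumes "f \<in> S" "g \<in> S" "h \<in> S"
  shows "conv (conv f g) h = conv f (conv g h)"
  using assms
proof (induction rule: steinberg_span.induct)
  case zero then show ?case by (simp add: conv_zero_left)
next
  case (char_fun U) then show ?case by (simp add: conv_ind_assoc)
next
  case (add f g) then show ?case by (simp add: conv_add_left)
next
  case (scale k f) then show ?case by (simp add: conv_scale_left)
qed

end

section \<open>The Steinberg algebra as a ring with involution\<close>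

context steinberg_setting
begin

abbreviation R where "R \<equiv> steinberg_algebra K G"

lemma steinberg_algebra_simps [simp]:
  "carrier R = S" "mult R = conv" "one R = ind (gunits G)" "zero R = (\<lambda>a. \<zero>)"
  "add R = (\<lambda>f h a. f a \<oplus> h a)"
  by (simp_all add: steinberg_algebra_def)

lemma span_outside: "\<lbrakk>f \<in> S; a \<notin> Arr\<rbrakk> \<Longrightarrow> f a = \<zero>"
  using span_Arr by blast

lemma conv_one_left: "f \<in> S \<Longrightarrow> conv (ind (gunits G)) f = f"
  by (rule ext) (simp add: conv_unit_ind_left cob_gunits span_outside)

lemma conv_one_right: "f \<in> S \<Longrightarrow> conv f (ind (gunits G)) = f"
  by (rule ext) (simp add: conv_unit_ind_right cob_gunits span_outside)

text \<open>Negatives are written as multiples by \<open>\<ominus> \<one>\<close>, since the span is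
  closed under scaling by construction.\<close>

lemma scale_minus_one: "f \<in> S \<Longrightarrow> (\<ominus> \<one> \<otimes> f a) \<oplus> f a = \<zero>"
  by (simp add: K.l_minus K.l_neg)

lemma ring_R: "ring R"
proof (rule ringI)
  show "abelian_group R"
  proof (rule abelian_groupI)
    fix f assume "f \<in> carrier R"
    then have "(\<lambda>a. \<ominus> \<one> \<otimes> f a) \<in> carrier R"
      by (simp add: steinberg_span.scale)
    moreover have "(\<lambda>a. \<ominus> \<one> \<otimes> f a) \<oplus>\<^bsub>R\<^esub> f = \<zero>\<^bsub>R\<^esub>"
      using \<open>f \<in> carrier R\<close> by (simp add: scale_minus_one)
    ultimately show "\<exists>h\<in>carrier R. h \<oplus>\<^bsub>R\<^esub> f = \<zero>\<^bsub>R\<^esub>" by blast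
  qed (auto simp: steinberg_span.add steinberg_span.zero K.a_ac)
  show "monoid R"
    by (rule monoidI) (simp_all add: cob_gunits conv_assoc conv_one_left conv_one_right)
qed (simp_all add: conv_add_left conv_add_right)

sublocale R: ring R by (rule ring_R)

lemma a_inv_R: "f \<in> S \<Longrightarrow> a_inv R f = (\<lambda>a. \<ominus> \<one> \<otimes> f a)"
  by (rule R.minus_equality) (simp_all add: scale_minus_one steinberg_span.scale)

lemma additive_subgroup_R:
  assumes "X \<subseteq> S" "(\<lambda>a. \<zero>) \<in> X" "\<And>f h. \<lbrakk>f \<in> X; h \<in> X\<rbrakk> \<Longrightarrow> (\<lambda>a. f a \<oplus> h a) \<in> X"
    "\<And>f. f \<in> X \<Longrightarrow> (\<lambda>a. \<ominus> \<one> \<otimes> f a) \<in> X"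
  shows "additive_subgroup X R"
proof (intro additive_subgroup.intro R.add.subgroupI)
  show "\<ominus>\<^bsub>R\<^esub> f \<in> X" if "f \<in> X" for f
    using that assms a_inv_R [of f] by auto
qed (use assms in auto)

lemma finsum_R_apply:
  assumes "finite A" "d \<in> A \<rightarrow> S"
  shows "finsum R d A a = (\<Oplus>i\<in>A. d i a)"
  using assms
proof (induction A rule: finite_induct)
  case (insert i A)
  have "finsum R d (insert i A) = d i \<oplus>\<^bsub>R\<^esub> finsum R d A"
    using insert by (intro R.finsum_insert) auto
  moreover have "d j a \<in> carrier K" if "j \<in> insert i A" for j
    using insert.prems that by (intro span_carrier) (rule funcset_mem)
  then have "(\<Oplus>j\<in>insert i A. d j a) = d i a \<oplus> (\<Oplus>j\<in>A. d j a)"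
    using insert.hyps by (intro K.finsum_insert) auto
  ultimately show ?case using insert by simp
qed simp

lemma finsum_R_closed:
  assumes "finite A" "d \<in> A \<rightarrow> X" "X \<subseteq> S" "(\<lambda>a. \<zero>) \<in> X"
    and add: "\<And>f h. \<lbrakk>f \<in> X; h \<in> X\<rbrakk> \<Longrightarrow> (\<lambda>a. f a \<oplus> h a) \<in> X"
  shows "finsum R d A \<in> X"
  using assms(1,2)
proof (induction A rule: finite_induct)
  case empty then show ?case using assms(4) by simp
next
  case (insert i A)
  then have "d \<in> A \<rightarrow> S" "d i \<in> S" using assms(3) by auto
  then have "finsum R d (insert i A) = d i \<oplus>\<^bsub>R\<^esub> finsum R d A"
    using insert by (intro R.finsum_insert) auto
  then show ?case using insert add [of "d i" "finsum R d A"] by simp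
qed

end

section \<open>The involution induced from the scalars\<close>

locale star_steinberg_setting = steinberg_setting G K
  for G :: "('g, 'x) tgroupoid_scheme" and K :: "('k, 'm) ring_scheme" (structure) +
  fixes \<sigma> :: "'k \<Rightarrow> 'k"
  assumes sigma: "ring_involution K \<sigma>"
begin

abbreviation star where "star \<equiv> steinberg_star K \<sigma> G"

lemma sigma_simps [simp]:
  "x \<in> carrier K \<Longrightarrow> \<sigma> x \<in> carrier K"
  "\<lbrakk>x \<in> carrier K; y \<in> carrier K\<rbrakk> \<Longrightarrow> \<sigma> (x \<oplus> y) = \<sigma> x \<oplus> \<sigma> y"
  "\<lbrakk>x \<in> carrier K; y \<in> carrier K\<rbrakk> \<Longrightarrow> \<sigma> (x \<otimes> y) = \<sigma> y \<otimes> \<sigma> x"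
  "x \<in> carrier K \<Longrightarrow> \<sigma> (\<sigma> x) = x"
  using sigma by (auto simp: ring_involution_def)

lemma sigma_zero [simp]: "\<sigma> \<zero> = \<zero>"
proof -
  have "\<sigma> \<zero> = \<sigma> \<zero> \<oplus> \<sigma> \<zero>" using sigma_simps(2) [of \<zero> \<zero>] by (simp del: sigma_simps(2))
  then show ?thesis using K.add.l_cancel_one' [of "\<sigma> \<zero>" "\<sigma> \<zero>"] by simp
qed

text \<open>Preserving \<open>\<one>\<close> is not an axiom of an involution. It follows by
  evaluating \<open>\<sigma> (\<sigma> \<one> \<otimes> \<one>)\<close> in two ways.\<close>

lemma sigma_one [simp]: "\<sigma> \<one> = \<one>"
proof -
  have "\<sigma> (\<sigma> \<one> \<otimes> \<one>) = \<sigma> \<one> \<otimes> \<sigma> (\<sigma> \<one>)" by (rule sigma_simps(3)) simp_all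
  then show ?thesis by simp
qed

lemma sigma_eq_zero [simp]: "x \<in> carrier K \<Longrightarrow> \<sigma> x = \<zero> \<longleftrightarrow> x = \<zero>"
  using sigma_simps(4) sigma_zero by metis

lemma sigma_finsum:
  assumes "finite A" "f \<in> A \<rightarrow> carrier K"
  shows "\<sigma> (\<Oplus>i\<in>A. f i) = (\<Oplus>i\<in>A. \<sigma> (f i))"
  using assms
proof (induction A rule: finite_induct)
  case (insert i A)
  have "(\<Oplus>j\<in>insert i A. f j) = f i \<oplus> (\<Oplus>j\<in>A. f j)"
    using insert by (intro K.finsum_insert) auto
  moreover have "\<sigma> (f j) \<in> carrier K" if "j \<in> insert i A" for j
    using insert.prems that by (intro sigma_simps(1)) (rule funcset_mem)
  then have "(\<Oplus>j\<in>insert i A. \<sigma> (f j)) = \<sigma> (f i) \<oplus> (\<Oplus>j\<in>A. \<sigma> (f j))"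
    using insert.hyps by (intro K.finsum_insert) auto
  moreover have "(\<Oplus>j\<in>A. f j) \<in> carrier K" "f i \<in> carrier K"
    using insert by auto
  ultimately show ?case using insert by simp
qed simp

lemma star_apply: "a \<in> Arr \<Longrightarrow> star f a = \<sigma> (f (ginverse a))"
  and star_outside: "a \<notin> Arr \<Longrightarrow> star f a = \<zero>"
  by (simp_all add: steinberg_star_def)

lemma star_span [simp]:
  assumes f: "f \<in> S"
  shows "star f \<in> S"
proof -
  have lc: "loc_const f" using f by (simp add: span_iff)
  have "loc_const (star f)"
  proof (rule loc_constI)
    show "star f a \<in> carrier K" for a using f by (simp add: steinberg_star_def)
    show "compactin (gtop G) (ginverse ` {a. f a \<noteq> \<zero>})"
      using lc image_compactin [OF _ continuous_inv] by (simp add: loc_const_def)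
    fix a assume a: "star f a \<noteq> \<zero>"
    then have "a \<in> Arr" using star_outside by blast
    then have "f (ginverse a) \<noteq> \<zero>" "a = ginverse (ginverse a)" using a by (auto simp: star_apply)
    then show "a \<in> ginverse ` {a. f a \<noteq> \<zero>}" by blast
  next
    fix k
    have "openin (gtop G) {a \<in> Arr. \<sigma> (f a) = k}"
      by (rule loc_const_open [OF lc])
    from openin_continuous_map_preimage [OF continuous_inv this]
    have "openin (gtop G) {a \<in> Arr. ginverse a \<in> {a \<in> Arr. \<sigma> (f a) = k}}" by simp
    also have "{a \<in> Arr. ginverse a \<in> {a \<in> Arr. \<sigma> (f a) = k}} = {a \<in> Arr. star f a = k}"
      by (auto simp: star_apply)
    finally show "openin (gtop G) {a \<in> Arr. star f a = k}" .
  qed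
  then show ?thesis by (simp add: span_iff)
qed

lemma star_add: "\<lbrakk>f \<in> S; h \<in> S\<rbrakk> \<Longrightarrow> star (\<lambda>a. f a \<oplus> h a) = (\<lambda>a. star f a \<oplus> star h a)"
  by (rule ext) (simp add: steinberg_star_def)

lemma star_star: "f \<in> S \<Longrightarrow> star (star f) = f"
  by (rule ext) (simp add: steinberg_star_def span_outside)

text \<open>A left factor \<open>a\<close> of \<open>ginverse x\<close> corresponds to the
  factorisation of \<open>x\<close> into \<open>x \<cdot> a\<close> and \<open>ginverse a\<close>.
  Reindexing by this bijection exchanges the roles of the two functions.\<close>

lemma star_conv:
  assumes f: "f \<in> S" and h: "h \<in> S"
  shows "star (conv f h) = conv (star h) (star f)"
proof
  fix x
  show "star (conv f h) x = conv (star h) (star f) x"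
  proof (cases "x \<in> Arr")
    case x: True
    let ?y = "ginverse x"
    let ?A = "{a \<in> Arr. rng a = rng ?y \<and> f a \<noteq> \<zero>}"
    have A: "a \<in> Arr" "rng a = src x" if "a \<in> ?A" for a using that x by auto
    have fin: "finite ?A" by (rule finite_fibre [OF f])
    have "star (conv f h) x = \<sigma> (\<Oplus>a\<in>?A. f a \<otimes> h (ginverse a \<cdot> ?y))"
      using x conv_eq_fibre_sum [OF f h, of ?y] by (simp add: star_apply)
    also have "\<dots> = (\<Oplus>a\<in>?A. \<sigma> (f a \<otimes> h (ginverse a \<cdot> ?y)))"
      by (rule sigma_finsum [OF fin]) (use f h in auto)
    also have "\<dots> = (\<Oplus>a\<in>?A. star h (x \<cdot> a) \<otimes> star f (ginverse (x \<cdot> a) \<cdot> x))"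
    proof (rule K.finsum_cong')
      show "(\<lambda>a. star h (x \<cdot> a) \<otimes> star f (ginverse (x \<cdot> a) \<cdot> x)) \<in> ?A \<rightarrow> carrier K"
        using f h by (intro funcsetI) simp
      fix a assume "a \<in> ?A"
      note a = A [OF this]
      have "star h (x \<cdot> a) = \<sigma> (h (ginverse a \<cdot> ?y))"
        using a x by (simp add: star_apply inv_mult)
      moreover have "ginverse (x \<cdot> a) \<cdot> x = ginverse a"
        using a x by (simp add: inv_mult)
      then have "star f (ginverse (x \<cdot> a) \<cdot> x) = \<sigma> (f a)"
        using a by (simp add: star_apply)
      ultimately show "\<sigma> (f a \<otimes> h (ginverse a \<cdot> ?y)) = star h (x \<cdot> a) \<otimes> star f (ginverse (x \<cdot> a) \<cdot> x)"
        using f h by simp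
    qed (rule refl)
    also have "\<dots> = (\<Oplus>b\<in>(\<lambda>a. x \<cdot> a) ` ?A. star h b \<otimes> star f (ginverse b \<cdot> x))"
    proof (rule K.finsum_reindex [symmetric])
      show "(\<lambda>b. star h b \<otimes> star f (ginverse b \<cdot> x)) \<in> (\<lambda>a. x \<cdot> a) ` ?A \<rightarrow> carrier K"
        using f h by (intro funcsetI) simp
      show "inj_on (\<lambda>a. x \<cdot> a) ?A"
      proof (rule inj_onI)
        fix a b assume ab: "a \<in> ?A" "b \<in> ?A" and eq: "x \<cdot> a = x \<cdot> b"
        have "a = ginverse x \<cdot> (x \<cdot> a)" using A [OF ab(1)] x by simp
        also have "\<dots> = b" unfolding eq using A [OF ab(2)] x by simp
        finally show "a = b" .
      qed
    qed
    also have "\<dots> = conv (star h) (star f) x"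
    proof (rule conv_eq_sum [symmetric])
      show "finite ((\<lambda>a. x \<cdot> a) ` ?A)" using fin by simp
      show "(\<lambda>a. x \<cdot> a) ` ?A \<subseteq> {a \<in> Arr. rng a = rng x}"
      proof (rule image_subsetI)
        fix a assume "a \<in> ?A"
        from A [OF this] show "x \<cdot> a \<in> {a \<in> Arr. rng a = rng x}" using x by simp
      qed
      fix b assume b: "b \<in> Arr" "rng b = rng x" "star f (ginverse b \<cdot> x) \<noteq> \<zero>"
      have "ginverse (ginverse b \<cdot> x) = ginverse x \<cdot> b" using b x by (simp add: inv_mult)
      then have "f (ginverse x \<cdot> b) \<noteq> \<zero>" using b x f by (auto simp: star_apply)
      then have "ginverse x \<cdot> b \<in> ?A" using b x by simp
      moreover have "b = x \<cdot> (ginverse x \<cdot> b)" using b x by simp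
      ultimately show "b \<in> (\<lambda>a. x \<cdot> a) ` ?A" by (rule rev_image_eqI)
    qed (use f h x in simp_all)
    finally show ?thesis .
  qed (simp add: star_outside conv_outside)
qed

lemma star_ring_involution: "ring_involution R star"
  by (auto simp: ring_involution_def star_add star_conv star_star)

text \<open>Units are their own inverses, and \<open>\<sigma>\<close> fixes \<open>\<zero>\<close>
  and \<open>\<one>\<close>.\<close>

lemma star_ind_units:
  assumes "W \<subseteq> gunits G"
  shows "star (ind W) = ind W"
proof
  fix a
  have "ginverse a \<in> W \<longleftrightarrow> a \<in> W" if "a \<in> Arr"
  proof
    assume "ginverse a \<in> W"
    then have "ginverse (ginverse a) = ginverse a" using assms unit_simps(4) by blast
    then show "a \<in> W" using that \<open>ginverse a \<in> W\<close> by simp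
  qed (use assms unit_simps(4) in force)
  moreover have "a \<notin> W" if "a \<notin> Arr" using that assms units_sub by blast
  ultimately show "star (ind W) a = ind W a"
    by (simp add: steinberg_star_def char_fun_def)
qed

end

section \<open>The grading\<close>

context steinberg_setting
begin

text \<open>Graded pieces, ideals of invariant sets of units and annihilators are all of this form,
  for conditions on the degree, source or range of an arrow.\<close>

definition supported :: "('g \<Rightarrow> bool) \<Rightarrow> ('g \<Rightarrow> 'k) set" where
  "supported P = {f \<in> S. \<forall>a. f a \<noteq> \<zero> \<longrightarrow> P a}"

lemma supportedD: "f \<in> supported P \<Longrightarrow> f \<in> S" "\<lbrakk>f \<in> supported P; f a \<noteq> \<zero>\<rbrakk> \<Longrightarrow> P a"
  by (auto simp: supported_def)

lemma supported_zero: "(\<lambda>a. \<zero>) \<in> supported P"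
  by (simp add: supported_def steinberg_span.zero)

lemma supported_add:
  assumes "f \<in> supported P" "h \<in> supported P"
  shows "(\<lambda>a. f a \<oplus> h a) \<in> supported P"
proof -
  have "P a" if "f a \<oplus> h a \<noteq> \<zero>" for a
  proof -
    have "f a \<noteq> \<zero> \<or> h a \<noteq> \<zero>" using that by auto
    then show ?thesis using assms supportedD(2) by blast
  qed
  then show ?thesis using assms by (simp add: supported_def steinberg_span.add)
qed

lemma additive_subgroup_supported: "additive_subgroup (supported P) R"
proof (rule additive_subgroup_R [OF _ supported_zero supported_add])
  fix f assume f: "f \<in> supported P"
  have "P a" if "\<ominus> \<one> \<otimes> f a \<noteq> \<zero>" for a
    using that supportedD(2) [OF f, of a] by (cases "f a = \<zero>") auto
  then show "(\<lambda>a. \<ominus> \<one> \<otimes> f a) \<in> supported P"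
    using f by (simp add: supported_def steinberg_span.scale)
qed (auto simp: supported_def)

end

section \<open>Degrees of arrows and homogeneous components\<close>

locale graded_steinberg_setting = star_steinberg_setting G K \<sigma> + \<Gamma>: group \<Gamma>
  for G :: "('g, 'x) tgroupoid_scheme" and K :: "('k, 'm) ring_scheme" (structure)
    and \<sigma> :: "'k \<Rightarrow> 'k" and \<Gamma> :: "('c, 'n) monoid_scheme" +
  fixes c :: "'g \<Rightarrow> 'c"
  assumes cocycle_c: "cocycle G \<Gamma> c"
begin

abbreviation grade where "grade \<equiv> steinberg_grade K G c"

lemma continuous_c: "continuous_map (gtop G) (discrete_topology (carrier \<Gamma>)) c"
  using cocycle_c by (simp add: cocycle_def)

lemma c_closed [simp]: "a \<in> Arr \<Longrightarrow> c a \<in> carrier \<Gamma>"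
  using continuous_map_image_subset_topspace [OF continuous_c] by auto

lemma c_mult: "\<lbrakk>a \<in> Arr; b \<in> Arr; src a = rng b\<rbrakk> \<Longrightarrow> c (a \<cdot> b) = c a \<otimes>\<^bsub>\<Gamma>\<^esub> c b"
  using cocycle_c composableI [of a b] by (auto simp: cocycle_def)

lemma c_unit:
  assumes "x \<in> gunits G"
  shows "c x = \<one>\<^bsub>\<Gamma>\<^esub>"
proof -
  have "x \<cdot> x = x" using unit_mult [of x x] assms by simp
  then have "c x = c x \<otimes>\<^bsub>\<Gamma>\<^esub> c x" using c_mult [of x x] assms by simp
  then show ?thesis using \<Gamma>.l_cancel_one' [of "c x" "c x"] assms by simp
qed

lemma c_inv:
  assumes "a \<in> Arr"
  shows "c (ginverse a) = inv\<^bsub>\<Gamma>\<^esub> c a"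
proof -
  have "c (ginverse a) \<otimes>\<^bsub>\<Gamma>\<^esub> c a = c (src a)"
    using assms c_mult [of "ginverse a" a] by (simp add: inv_mult_self)
  then have "c (ginverse a) \<otimes>\<^bsub>\<Gamma>\<^esub> c a = \<one>\<^bsub>\<Gamma>\<^esub>" using assms c_unit by simp
  then show ?thesis using \<Gamma>.inv_equality assms by force
qed

text \<open>The group is discrete, so any condition on degrees is open and, by negation, closed.
  Cutting a function down to one degree therefore keeps it locally constant.\<close>

lemma openin_c: "openin (gtop G) {a \<in> Arr. P (c a)}"
proof -
  have "openin (gtop G) {a \<in> topspace (gtop G). c a \<in> {g \<in> carrier \<Gamma>. P g}}"
    by (rule openin_continuous_map_preimage [OF continuous_c]) auto
  also have "{a \<in> topspace (gtop G). c a \<in> {g \<in> carrier \<Gamma>. P g}} = {a \<in> Arr. P (c a)}"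
    by auto
  finally show ?thesis .
qed

lemma closedin_c: "closedin (gtop G) {a \<in> Arr. P (c a)}"
proof -
  have "closedin (gtop G) (Arr - {a \<in> Arr. \<not> P (c a)})"
    using openin_c [of "\<lambda>g. \<not> P g"] by (simp add: closedin_diff)
  also have "Arr - {a \<in> Arr. \<not> P (c a)} = {a \<in> Arr. P (c a)}" by auto
  finally show ?thesis .
qed

definition component :: "('g \<Rightarrow> 'k) \<Rightarrow> 'c \<Rightarrow> 'g \<Rightarrow> 'k" where
  "component f g = (\<lambda>a. if a \<in> {a \<in> Arr. c a = g} then f a else \<zero>)"

lemma component_grade:
  assumes "f \<in> S"
  shows "component f g \<in> grade g"
proof -
  have "loc_const (component f g)"
    unfolding component_def
    using assms by (intro loc_const_restrict openin_c closedin_c) (simp add: span_iff)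
  then show ?thesis by (auto simp: steinberg_grade_def span_iff component_def)
qed

lemma grade_span: "f \<in> grade g \<Longrightarrow> f \<in> S"
  and grade_c: "\<lbrakk>f \<in> grade g; f a \<noteq> \<zero>\<rbrakk> \<Longrightarrow> c a = g"
  by (auto simp: steinberg_grade_def)

text \<open>This is the domain, and \<open>family_sum\<close> the map, of the bijection in
  \<open>internal_direct_sum\<close> for the pieces \<open>X \<inter> grade g\<close>.\<close>

definition homogeneous_families :: "('g \<Rightarrow> 'k) set \<Rightarrow> ('c \<Rightarrow> 'g \<Rightarrow> 'k) set" where
  "homogeneous_families X =
     {d \<in> \<Pi>\<^sub>E g\<in>carrier \<Gamma>. X \<inter> grade g. finite {g\<in>carrier \<Gamma>. d g \<noteq> \<zero>\<^bsub>R\<^esub>}}"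

definition family_sum :: "('c \<Rightarrow> 'g \<Rightarrow> 'k) \<Rightarrow> 'g \<Rightarrow> 'k" where
  "family_sum d = finsum R d {g\<in>carrier \<Gamma>. d g \<noteq> \<zero>\<^bsub>R\<^esub>}"

text \<open>Pieces of different degrees have disjoint supports, so at \<open>a\<close> only the
  member of degree \<open>c a\<close> can contribute. Off the arrows \<open>c\<close> is
  unconstrained, hence the separate value.\<close>

lemma family_sum_apply:
  assumes d: "d \<in> homogeneous_families X"
  shows "family_sum d a = (if a \<in> Arr then d (c a) a else \<zero>)"
proof -
  let ?I = "{g\<in>carrier \<Gamma>. d g \<noteq> \<zero>\<^bsub>R\<^esub>}"
  have dg: "d g \<in> grade g" if "g \<in> carrier \<Gamma>" for g
    using d that by (auto simp: homogeneous_families_def)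
  have fin: "finite ?I" using d by (auto simp: homogeneous_families_def)
  have dS: "d g \<in> S" if "g \<in> carrier \<Gamma>" for g using grade_span [OF dg [OF that]] .
  have eq: "family_sum d a = (\<Oplus>g\<in>?I. d g a)"
    unfolding family_sum_def by (rule finsum_R_apply [OF fin]) (use dS in blast)
  show ?thesis
  proof (cases "a \<in> Arr \<and> c a \<in> ?I")
    case True
    have "(\<Oplus>g\<in>?I. d g a) = (\<Oplus>g\<in>?I. if c a = g then d g a else \<zero>)"
    proof (rule K.finsum_cong')
      show "(\<lambda>g. if c a = g then d g a else \<zero>) \<in> ?I \<rightarrow> carrier K"
        by (intro funcsetI) (simp add: dS)
      fix g assume "g \<in> ?I"
      then show "d g a = (if c a = g then d g a else \<zero>)" using grade_c [OF dg] by auto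
    qed (rule refl)
    also have "\<dots> = d (c a) a"
    proof (rule K.finsum_singleton)
      show "(\<lambda>g. d g a) \<in> ?I \<rightarrow> carrier K" by (intro funcsetI) (simp add: dS)
    qed (use True fin in auto)
    finally show ?thesis using eq True by simp
  next
    case False
    have "d g a = \<zero>" if g: "g \<in> ?I" for g
    proof (rule ccontr)
      assume nz: "d g a \<noteq> \<zero>"
      then have "c a = g" "a \<in> Arr" using grade_c [OF dg] span_Arr [OF dS] g by auto
      then show False using False g by simp
    qed
    then have "(\<Oplus>g\<in>?I. d g a) = \<zero>" by (rule K.add.finprod_one_eqI)
    moreover have "d (c a) a = \<zero>" if "a \<in> Arr" using False that by auto
    ultimately show ?thesis using eq by simp
  qed
qed

text \<open>Summation is inverted by taking components. Only finitely many of these are nonzero,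
  because \<open>c\<close> maps the compact support to a compact, hence finite, set of degrees. The
  lemma serves both the whole algebra and the ideals of invariant sets.\<close>

lemma direct_sum_grades:
  assumes X: "X \<subseteq> S" "(\<lambda>a. \<zero>) \<in> X" "\<And>f h. \<lbrakk>f \<in> X; h \<in> X\<rbrakk> \<Longrightarrow> (\<lambda>a. f a \<oplus> h a) \<in> X"
    and comp: "\<And>f g. \<lbrakk>f \<in> X; g \<in> carrier \<Gamma>\<rbrakk> \<Longrightarrow> component f g \<in> X"
  shows "internal_direct_sum R (carrier \<Gamma>) (\<lambda>g. X \<inter> grade g) X"
proof -
  have family: "restrict (component f) (carrier \<Gamma>) \<in> homogeneous_families X" (is "?d \<in> _")
    if f: "f \<in> X" for f
  proof -
    have fS: "f \<in> S" using f X by blast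
    then have "compactin (discrete_topology (carrier \<Gamma>)) (c ` {a. f a \<noteq> \<zero>})"
      by (intro image_compactin [OF _ continuous_c]) (simp add: span_iff loc_const_def)
    then have "finite (c ` {a. f a \<noteq> \<zero>})" by (simp add: compactin_discrete_topology)
    then have "finite {g \<in> carrier \<Gamma>. ?d g \<noteq> \<zero>\<^bsub>R\<^esub>}"
      by (rule rev_finite_subset) (auto simp: component_def fun_eq_iff split: if_splits)
    then show ?thesis
      using comp [OF f] component_grade [OF fS] by (auto simp: homogeneous_families_def)
  qed
  have "bij_betw family_sum (homogeneous_families X) X"
  proof (rule bij_betwI)
    show "family_sum \<in> homogeneous_families X \<rightarrow> X"
    proof
      fix d assume d: "d \<in> homogeneous_families X"
      show "family_sum d \<in> X"
        unfolding family_sum_def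
      proof (rule finsum_R_closed)
        show "finite {g \<in> carrier \<Gamma>. d g \<noteq> \<zero>\<^bsub>R\<^esub>}" "d \<in> {g \<in> carrier \<Gamma>. d g \<noteq> \<zero>\<^bsub>R\<^esub>} \<rightarrow> X"
          using d by (auto simp: homogeneous_families_def)
      qed (use X in auto)
    qed
    show "(\<lambda>f. restrict (component f) (carrier \<Gamma>)) \<in> X \<rightarrow> homogeneous_families X"
      using family by blast
  next
    fix d assume d: "d \<in> homogeneous_families X"
    then have dg: "d g \<in> grade g" if "g \<in> carrier \<Gamma>" for g
      using that by (auto simp: homogeneous_families_def)
    show "restrict (component (family_sum d)) (carrier \<Gamma>) = d"
    proof (rule extensionalityI)
      show "d \<in> extensional (carrier \<Gamma>)"
        using d by (simp add: homogeneous_families_def PiE_iff)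
      fix g assume g: "g \<in> carrier \<Gamma>"
      have "component (family_sum d) g a = d g a" for a
        using grade_c [OF dg [OF g], of a] span_Arr [OF grade_span [OF dg [OF g]], of a]
        by (cases "d g a = \<zero>") (auto simp: component_def family_sum_apply [OF d])
      then show "restrict (component (family_sum d)) (carrier \<Gamma>) g = d g" using g by auto
    qed simp
  next
    fix f assume f: "f \<in> X"
    then have fS: "f \<in> S" using X by blast
    show "family_sum (restrict (component f) (carrier \<Gamma>)) = f"
    proof
      fix a
      show "family_sum (restrict (component f) (carrier \<Gamma>)) a = f a"
        using family_sum_apply [OF family [OF f]] span_outside [OF fS, of a]
        by (simp add: component_def)
    qed
  qed
  then show ?thesis
    by (simp add: internal_direct_sum_def homogeneous_families_def family_sum_def [abs_def])
qed

text \<open>Decompose \<open>f\<close> inside \<open>I\<close>: the member of degree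
  \<open>c a\<close> agrees with \<open>f\<close> at \<open>a\<close>, because the other members
  vanish there.\<close>

lemma graded_ideal_component:
  assumes I: "graded_ideal R \<Gamma> grade I" and f: "f \<in> I" "a \<in> Arr"
  obtains h where "h \<in> I" "h \<in> grade (c a)" "h a = f a"
proof -
  have "bij_betw family_sum (homogeneous_families I) I"
    using I by (simp add: graded_ideal_def internal_direct_sum_def homogeneous_families_def
        family_sum_def [abs_def])
  then obtain d where d: "d \<in> homogeneous_families I" "f = family_sum d"
    using f(1) by (auto simp: bij_betw_def)
  then have "d (c a) \<in> I" "d (c a) \<in> grade (c a)" using f(2) by (auto simp: homogeneous_families_def)
  moreover have "d (c a) a = f a" using family_sum_apply [OF d(1), of a] d(2) f(2) by simp
  ultimately show thesis using that by blast
qed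

lemma graded_star_ring_R: "graded_star_ring R \<Gamma> grade star"
proof (intro graded_star_ring.intro graded_ring.intro graded_ring_axioms.intro
    graded_star_ring_axioms.intro ring_R \<Gamma>.group_axioms star_ring_involution)
  fix g assume "g \<in> carrier \<Gamma>"
  show "additive_subgroup (grade g) R"
    using additive_subgroup_supported [of "\<lambda>a. c a = g"]
    by (simp add: supported_def steinberg_grade_def)
  show "star ` grade g \<subseteq> grade (inv\<^bsub>\<Gamma>\<^esub> g)"
  proof
    fix h assume "h \<in> star ` grade g"
    then obtain f where f: "f \<in> grade g" "h = star f" by blast
    have "c a = inv\<^bsub>\<Gamma>\<^esub> g" if "star f a \<noteq> \<zero>" for a
    proof -
      have a: "a \<in> Arr" using that star_outside by blast
      then have "f (ginverse a) \<noteq> \<zero>" using that by (auto simp: star_apply)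
      then have "c (ginverse a) = g" using grade_c [OF f(1)] by blast
      then show ?thesis using a c_inv [of "ginverse a"] by simp
    qed
    then show "h \<in> grade (inv\<^bsub>\<Gamma>\<^esub> g)" using f by (auto simp: steinberg_grade_def)
  qed
next
  fix g h x y assume x: "x \<in> grade g" and y: "y \<in> grade h"
  have "c a = g \<otimes>\<^bsub>\<Gamma>\<^esub> h" if nz: "conv x y a \<noteq> \<zero>" for a
  proof -
    obtain u v where "u \<in> Arr" "v \<in> Arr" "src u = rng v" "a = u \<cdot> v" "x u \<noteq> \<zero>" "y v \<noteq> \<zero>"
      using conv_nonzeroE [OF grade_span [OF x] grade_span [OF y] nz] .
    then show ?thesis using grade_c [OF x] grade_c [OF y] c_mult by simp
  qed
  then show "x \<otimes>\<^bsub>R\<^esub> y \<in> grade (g \<otimes>\<^bsub>\<Gamma>\<^esub> h)"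
    using grade_span [OF x] grade_span [OF y] by (simp add: steinberg_grade_def)
next
  have "internal_direct_sum R (carrier \<Gamma>) (\<lambda>g. S \<inter> grade g) S"
    by (rule direct_sum_grades)
      (auto simp: steinberg_span.zero steinberg_span.add grade_span [OF component_grade])
  moreover have "(\<lambda>g. S \<inter> grade g) = grade" using grade_span by blast
  ultimately show "internal_direct_sum R (carrier \<Gamma>) grade (carrier R)" by simp
qed

end

section \<open>Annihilators of graded ideals\<close>

context graded_steinberg_setting
begin

lemma openin_support: "f \<in> S \<Longrightarrow> openin (gtop G) {a. f a \<noteq> \<zero>}"
proof -
  assume f: "f \<in> S"
  then have "{a \<in> Arr. f a \<noteq> \<zero>} = {a. f a \<noteq> \<zero>}" using span_Arr by blast
  then show ?thesis using loc_const_open [of f "\<lambda>v. v \<noteq> \<zero>"] f by (simp add: span_iff)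
qed

lemma compactin_support: "f \<in> S \<Longrightarrow> compactin (gtop G) {a. f a \<noteq> \<zero>}"
  by (simp add: span_iff loc_const_def)

text \<open>If \<open>f\<close> annihilates \<open>I\<close> and the open set of ranges of its
  support met \<open>U\<close>, density would give some \<open>ind W'\<close> in \<open>I\<close>
  whose product with \<open>f\<close> is nonzero. Conversely, a nonzero product needs an arrow with
  source in \<open>U\<close> to meet one with range in \<open>?V\<close>. Both directions of the
  theorem use this: \<open>dense\<close> is immediate for the ideal of an open invariant set and
  comes from effectiveness for an arbitrary graded ideal.\<close>

lemma right_annihilator_eq:
  assumes I: "I \<subseteq> S" and U: "U \<subseteq> gunits G"
    and supp: "\<And>f a. \<lbrakk>f \<in> I; f a \<noteq> \<zero>\<rbrakk> \<Longrightarrow> src a \<in> U"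
    and dense: "\<And>W x. \<lbrakk>openin (gtop G) W; x \<in> W; x \<in> U\<rbrakk> \<Longrightarrow>
      \<exists>W'. compact_open_bisection G W' \<and> W' \<noteq> {} \<and> W' \<subseteq> W \<inter> gunits G \<and> ind W' \<in> I"
  shows "right_annihilator R I = supported (\<lambda>a. rng a \<in> unit_top G interior_of (gunits G - U))"
    (is "_ = supported (\<lambda>a. rng a \<in> ?V)")
proof (intro subset_antisym subsetI)
  fix f assume "f \<in> right_annihilator R I"
  then have f: "f \<in> S" and ann: "\<And>g. g \<in> I \<Longrightarrow> conv g f = (\<lambda>a. \<zero>)"
    by (auto simp: right_annihilator_def)
  let ?W = "rng ` {a. f a \<noteq> \<zero>}"
  have W: "openin (unit_top G) ?W"
    using open_map_rng openin_support [OF f] by (simp add: open_map_def)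
  have "?W \<inter> U = {}"
  proof (rule ccontr)
    assume "?W \<inter> U \<noteq> {}"
    then obtain x where "x \<in> ?W" "x \<in> U" by blast
    then obtain W' where W': "compact_open_bisection G W'" "W' \<noteq> {}" "W' \<subseteq> ?W \<inter> gunits G" "ind W' \<in> I"
      using dense [of ?W x] W by (auto simp: openin_unit_top)
    then obtain b where b: "rng b \<in> W'" "f b \<noteq> \<zero>" by blast
    have "conv (ind W') f b = f b"
      using conv_unit_ind_left [OF W'(1) _ f, of b] W'(3) b span_Arr [OF f b(2)] by simp
    then show False using ann [OF W'(4)] b(2) by simp
  qed
  then have "?W \<subseteq> gunits G - U" using openin_subset [OF W] by auto
  then have "?W \<subseteq> ?V" using W by (rule interior_of_maximal)
  then show "f \<in> supported (\<lambda>a. rng a \<in> ?V)" using f by (auto simp: supported_def)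
next
  fix f assume f: "f \<in> supported (\<lambda>a. rng a \<in> ?V)"
  note fS = supportedD(1) [OF f]
  have "conv g f x = \<zero>" if g: "g \<in> I" for g x
  proof (rule ccontr)
    assume nz: "conv g f x \<noteq> \<zero>"
    have gS: "g \<in> S" using g I by blast
    obtain a b where ab: "src a = rng b" "g a \<noteq> \<zero>" "f b \<noteq> \<zero>"
      using conv_nonzeroE [OF gS fS nz] by metis
    have "src a \<in> U" "rng b \<in> gunits G - U"
      using supp [OF g ab(2)] supportedD(2) [OF f ab(3)] interior_of_subset [of "unit_top G"] by auto
    then show False using ab(1) by simp
  qed
  then show "f \<in> right_annihilator R I" using fS by (auto simp: right_annihilator_def)
qed

text \<open>The indicator is a left identity on functions living over \<open>V\<close> and cuts any
  other function down to one of these.\<close>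

lemma supported_rng_eq_ind_mult:
  assumes V: "compact_open_bisection G V" "V \<subseteq> gunits G"
  shows "supported (\<lambda>a. rng a \<in> V) = (\<lambda>r. ind V \<otimes>\<^bsub>R\<^esub> r) ` carrier R"
proof (intro subset_antisym subsetI)
  fix f assume f: "f \<in> supported (\<lambda>a. rng a \<in> V)"
  note fS = supportedD(1) [OF f]
  have "conv (ind V) f a = f a" for a
    using conv_unit_ind_left [OF V fS, of a] supportedD(2) [OF f, of a] span_Arr [OF fS, of a]
    by (cases "f a = \<zero>") auto
  then have "f = ind V \<otimes>\<^bsub>R\<^esub> f" by auto
  then show "f \<in> (\<lambda>r. ind V \<otimes>\<^bsub>R\<^esub> r) ` carrier R" using fS by auto
next
  fix f assume "f \<in> (\<lambda>r. ind V \<otimes>\<^bsub>R\<^esub> r) ` carrier R"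
  then obtain r where r: "r \<in> S" "f = conv (ind V) r" by auto
  then show "f \<in> supported (\<lambda>a. rng a \<in> V)"
    using V conv_unit_ind_left [OF V r(1)] by (auto simp: supported_def)
qed

lemma projection_ind:
  assumes V: "compact_open_bisection G V" "V \<subseteq> gunits G"
  shows "projection R star (ind V)" "homogeneous \<Gamma> grade (ind V)"
proof -
  have "conv (ind V) (ind V) a = ind V a" for a
    using conv_unit_ind_left [OF V ind_span [OF V(1)], of a] V(2) units_sub
    by (auto simp: char_fun_def)
  then have "ind V = conv (ind V) (ind V)" by auto
  then show "projection R star (ind V)"
    using V star_ind_units [OF V(2)] by (simp add: projection_def)
  have "ind V \<in> grade \<one>\<^bsub>\<Gamma>\<^esub>"
  proof -
    have "c a = \<one>\<^bsub>\<Gamma>\<^esub>" if "ind V a \<noteq> \<zero>" for a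
      using that V(2) c_unit by (auto simp: char_fun_def split: if_splits)
    then show ?thesis using V(1) by (simp add: steinberg_grade_def)
  qed
  then show "homogeneous \<Gamma> grade (ind V)"
    unfolding homogeneous_def using \<Gamma>.one_closed by blast
qed

text \<open>A left multiplication keeps the source of the right factor; a right multiplication moves
  it along an arrow, which is where invariance enters. Taking components only shrinks supports, so
  the ideal is graded.\<close>

lemma graded_ideal_of_invariant:
  assumes U: "invariant G U"
  shows "graded_ideal R \<Gamma> grade (supported (\<lambda>a. src a \<in> U))" (is "graded_ideal _ _ _ ?I")
  unfolding graded_ideal_def
proof
  show "ideal ?I R"
  proof (rule idealI [OF ring_R])
    show "subgroup ?I (add_monoid R)"
      using additive_subgroup_supported by (rule additive_subgroup.a_subgroup)
    fix f g assume f: "f \<in> ?I" and "g \<in> carrier R"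
    then have gS: "g \<in> S" by simp
    note fS = supportedD(1) [OF f]
    have "src x \<in> U" if nz: "conv g f x \<noteq> \<zero>" for x
    proof -
      obtain a b where "a \<in> Arr" "b \<in> Arr" "src a = rng b" "x = a \<cdot> b" "f b \<noteq> \<zero>"
        using conv_nonzeroE [OF gS fS nz] by metis
      then show ?thesis using supportedD(2) [OF f] by simp
    qed
    then show "g \<otimes>\<^bsub>R\<^esub> f \<in> ?I" using fS gS by (simp add: supported_def)
    have "src x \<in> U" if nz: "conv f g x \<noteq> \<zero>" for x
    proof -
      obtain a b where ab: "a \<in> Arr" "b \<in> Arr" "src a = rng b" "x = a \<cdot> b" "f a \<noteq> \<zero>"
        using conv_nonzeroE [OF fS gS nz] by metis
      then have "rng b \<in> U" using supportedD(2) [OF f ab(5)] by simp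
      then show ?thesis using invariant_rng_iff [OF U ab(2)] ab by simp
    qed
    then show "f \<otimes>\<^bsub>R\<^esub> g \<in> ?I" using fS gS by (simp add: supported_def)
  qed
  show "internal_direct_sum R (carrier \<Gamma>) (\<lambda>g. ?I \<inter> grade g) ?I"
  proof (rule direct_sum_grades [OF _ supported_zero supported_add])
    fix f g assume f: "f \<in> ?I"
    then show "component f g \<in> ?I"
      using grade_span [OF component_grade [OF supportedD(1) [OF f]], of g] supportedD(2) [OF f]
      by (auto simp: supported_def component_def)
  qed (auto simp: supported_def)
qed

text \<open>\<open>?V\<close> is recovered from a generator \<open>p\<close> of the annihilator as
  the set of units in its support, an intersection of a compact set with a closed one.\<close>

lemma compact_interior_if_quasi_Baer:
  assumes Baer: "graded_quasi_Baer_star_ring R \<Gamma> grade star"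
    and U: "openin (unit_top G) U" "invariant G U"
  shows "compactin (unit_top G) (unit_top G interior_of (gunits G - U))" (is "compactin _ ?V")
proof -
  let ?I = "supported (\<lambda>a. src a \<in> U)"
  have UG: "U \<subseteq> gunits G" "openin (gtop G) U" using U(1) by (auto simp: openin_unit_top)
  have V: "openin (gtop G) ?V" "?V \<subseteq> gunits G"
    using openin_interior_of [of "unit_top G" "gunits G - U"] by (auto simp only: openin_unit_top)
  obtain p where p: "projection R star p" "right_annihilator R ?I = (\<lambda>r. p \<otimes>\<^bsub>R\<^esub> r) ` carrier R"
    using graded_quasi_Baer_star_ring.quasi_Baer [OF Baer graded_ideal_of_invariant [OF U(2)]] by blast
  have pS: "p \<in> S" and pp: "conv p p = p" using p(1) by (auto simp: projection_def)
  have ann: "right_annihilator R ?I = supported (\<lambda>a. rng a \<in> ?V)"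
  \<comment> \<open>As \<open>U\<close> is open, a small bisection inside
    \<open>W \<inter> U\<close> already has its indicator in \<open>?I\<close>.\<close>
  proof (rule right_annihilator_eq)
    fix W x assume W: "openin (gtop G) W" "x \<in> W" "x \<in> U"
    obtain W' where W': "compact_open_bisection G W'" "x \<in> W'" "W' \<subseteq> W \<inter> U"
      using ex_cob [of "W \<inter> U" x] W UG by (auto simp: openin_Int)
    have "src a \<in> U" if "ind W' a \<noteq> \<zero>" for a
    proof -
      have "a \<in> U" using that W'(3) by (auto simp: char_fun_def split: if_splits)
      then show ?thesis using unit_simps(2) [of a] UG by auto
    qed
    then have "ind W' \<in> ?I" using W'(1) by (simp add: supported_def)
    then show "\<exists>W'. compact_open_bisection G W' \<and> W' \<noteq> {} \<and> W' \<subseteq> W \<inter> gunits G \<and> ind W' \<in> ?I"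
      using W' UG by blast
  qed (use UG in \<open>auto simp: supported_def\<close>)
  \<comment> \<open>Multiplying \<open>p\<close> by the identity puts \<open>p\<close> itself into
    the annihilator, which confines its support to arrows with range in \<open>?V\<close>.\<close>
  have "conv p (ind (gunits G)) = p" by (rule conv_one_right [OF pS])
  then have "p \<in> (\<lambda>r. p \<otimes>\<^bsub>R\<^esub> r) ` carrier R"
    using ind_span [OF cob_gunits] by (intro rev_image_eqI [of "ind (gunits G)"]) simp_all
  then have pV: "p \<in> supported (\<lambda>a. rng a \<in> ?V)" using p(2) ann by simp
  have "?V = {a. p a \<noteq> \<zero>} \<inter> gunits G"
  proof (intro subset_antisym subsetI)
    fix x assume x: "x \<in> ?V"
    then have xu: "x \<in> gunits G" using V by blast
    obtain W where W: "compact_open_bisection G W" "x \<in> W" "W \<subseteq> ?V" using ex_cob [OF V(1) x] .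
    have "rng a \<in> ?V" if "ind W a \<noteq> \<zero>" for a
    proof -
      have "a \<in> ?V" using that W(3) by (auto simp: char_fun_def split: if_splits)
      then show ?thesis using unit_simps(3) [of a] V by auto
    qed
    then have "ind W \<in> supported (\<lambda>a. rng a \<in> ?V)" using W(1) by (simp add: supported_def)
    then have "ind W \<in> (\<lambda>r. p \<otimes>\<^bsub>R\<^esub> r) ` carrier R" using ann p(2) by simp
    then obtain r where r: "r \<in> S" "ind W = conv p r" by auto
    \<comment> \<open>An idempotent is a left identity on the right ideal it generates, so it fixes
      \<open>ind W\<close>; at the unit \<open>x\<close> this says
      \<open>p x = \<one>\<close>.\<close>
    have "conv p (ind W) = conv (conv p p) r" using r pS conv_assoc by simp
    then have "conv p (ind W) = ind W" using pp r by simp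
    then have "conv p (ind W) x = \<one>" using W(2) by (simp add: char_fun_def)
    moreover have "conv p (ind W) x = p x"
      using conv_unit_ind_right [OF W(1) _ pS, of x] W V xu by auto
    ultimately show "x \<in> {a. p a \<noteq> \<zero>} \<inter> gunits G" using xu by simp
  next
    fix x assume "x \<in> {a. p a \<noteq> \<zero>} \<inter> gunits G"
    then show "x \<in> ?V" using supportedD(2) [OF pV, of x] by simp
  qed
  then have "compactin (gtop G) ?V"
    using compact_Int_closedin [OF compactin_support [OF pS] compactin_closed [OF compactin_units]] by simp
  then show ?thesis using V by (simp add: compactin_unit_top)
qed

end

section \<open>Strong effectiveness: indicators inside graded ideals\<close>

locale effective_steinberg_setting = graded_steinberg_setting +
  assumes kernel_effective: "strongly_effective (cocycle_kernel G \<Gamma> c)"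
begin

text \<open>Strong effectiveness is applied to the whole unit space, which is closed and invariant.
  The rest identifies source, range, arrows and units of the two nested subgroupoids: the operations
  are those of \<open>G\<close>, and only the topology is restricted.\<close>

lemma kernel_isotropy_interior:
  assumes T: "openin (gtop G) T" "\<And>a. a \<in> T \<Longrightarrow> c a = \<one>\<^bsub>\<Gamma>\<^esub> \<and> src a = rng a"
  shows "T \<subseteq> gunits G"
proof -
  let ?N = "{a \<in> Arr. c a = \<one>\<^bsub>\<Gamma>\<^esub>}"
  let ?H = "cocycle_kernel G \<Gamma> c"
  have H: "gtop ?H = subtopology (gtop G) ?N" "gmult ?H = gmult G" "ginv ?H = ginv G"
    by (simp_all add: cocycle_kernel_def subgroupoid_on_def)
  have sr: "gsrc ?H = src" "grng ?H = rng" by (auto simp: gsrc_def [abs_def] grng_def [abs_def] H)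
  have arr: "arrows ?H = ?N" by (auto simp: arrows_def [of ?H] H)
  have un: "gunits ?H = gunits G"
  proof
    show "gunits ?H \<subseteq> gunits G" by (auto simp: gunits_def [of ?H] arr sr)
    show "gunits G \<subseteq> gunits ?H"
    proof
      fix x assume x: "x \<in> gunits G"
      then have "x \<in> ?N" "x = src x" using c_unit by simp_all
      then show "x \<in> gunits ?H" unfolding gunits_def [of ?H] arr sr by (rule rev_image_eqI)
    qed
  qed
  have "topspace (unit_top ?H) = gunits G"
    using c_unit by (auto simp: unit_top_def un H)
  then have "closedin (unit_top ?H) (gunits G)" using closedin_topspace by metis
  moreover have "invariant ?H (gunits G)" by (auto simp: invariant_def un arr sr)
  ultimately have eff: "effective (restrict_units ?H (gunits G))"
    using kernel_effective by (simp add: strongly_effective_def)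
  let ?L = "restrict_units ?H (gunits G)"
  have "{a \<in> arrows ?H. gsrc ?H a \<in> gunits G} = ?N" by (auto simp: arr sr)
  then have L: "gtop ?L = subtopology (gtop G) ?N" "gmult ?L = gmult G" "ginv ?L = ginv G"
    by (simp_all add: restrict_units_def subgroupoid_on_def H subtopology_subtopology)
  have srL: "gsrc ?L = src" "grng ?L = rng" by (auto simp: gsrc_def [abs_def] grng_def [abs_def] L)
  have arrL: "arrows ?L = ?N" by (auto simp: arrows_def [of ?L] L)
  have TN: "T \<subseteq> ?N" using T openin_Arr by blast
  then have "T \<subseteq> isotropy ?L" using T(2) by (auto simp: isotropy_def arrL srL)
  moreover have "openin (gtop ?L) T" using T(1) TN by (auto simp: L openin_subtopology)
  ultimately have "T \<subseteq> gtop ?L interior_of isotropy ?L" by (rule interior_of_maximal)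
  also have "\<dots> = gunits ?L" using eff by (simp add: effective_def)
  also have "\<dots> \<subseteq> gunits G" by (auto simp: gunits_def [of ?L] arrL srL)
  finally show ?thesis .
qed

text \<open>Effectiveness in usable form: a nonempty open set of units can be shrunk until no arrow
  of the given bisections both starts and ends in it. The bisections are treated one at a time, and
  later shrinking does not spoil what was achieved before.\<close>

lemma shrink_off_bisections:
  assumes "finite F"
    and "\<And>B. B \<in> F \<Longrightarrow> open_bisection G B \<and> B \<inter> gunits G = {} \<and> (\<forall>b\<in>B. c b = \<one>\<^bsub>\<Gamma>\<^esub>)"
    and "openin (gtop G) W" "W \<subseteq> gunits G" "W \<noteq> {}"
  shows "\<exists>W'. openin (gtop G) W' \<and> W' \<subseteq> W \<and> W' \<noteq> {} \<and> (\<forall>b\<in>\<Union>F. \<not> (src b \<in> W' \<and> rng b \<in> W'))"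
  using assms(1,2)
proof (induction F rule: finite_induct)
  case empty
  then show ?case using assms by auto
next
  case (insert B F)
  obtain W1 where W1: "openin (gtop G) W1" "W1 \<subseteq> W" "W1 \<noteq> {}"
    "\<forall>b\<in>\<Union>F. \<not> (src b \<in> W1 \<and> rng b \<in> W1)" using insert.IH insert.prems by auto
  have B: "openin (gtop G) B" "inj_on src B" "B \<inter> gunits G = {}" "\<forall>b\<in>B. c b = \<one>\<^bsub>\<Gamma>\<^esub>"
    using insert.prems [of B] by (auto simp: open_bisection_iff)
  let ?B = "B \<inter> {a \<in> Arr. src a \<in> W1} \<inter> {a \<in> Arr. rng a \<in> W1}"
  have oB: "openin (gtop G) ?B"
    using B(1) W1(1) openin_src_vimage openin_rng_vimage by (intro openin_Int) auto
  show ?case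
  proof (cases "?B = {}")
    case True
    then have "\<forall>b\<in>\<Union>(insert B F). \<not> (src b \<in> W1 \<and> rng b \<in> W1)"
      using W1(4) openin_Arr [OF B(1)] by blast
    then show ?thesis using W1 by blast
  next
    case False
    \<comment> \<open>Otherwise \<open>?B\<close> would be a nonempty open set of isotropy in the
      identity degree, hence of units, which \<open>B\<close> avoids.\<close>
    have "\<exists>b\<in>?B. src b \<noteq> rng b"
    proof (rule ccontr)
      assume "\<not> ?thesis"
      then have "c b = \<one>\<^bsub>\<Gamma>\<^esub> \<and> src b = rng b" if "b \<in> ?B" for b using that B(4) by blast
      from kernel_isotropy_interior [OF oB this] show False using False B(3) by blast
    qed
    then obtain b where b: "b \<in> B" "b \<in> Arr" "src b \<in> W1" "rng b \<in> W1" "src b \<noteq> rng b" by blast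
    obtain P Q where PQ: "openin (gtop G) P" "openin (gtop G) Q" "src b \<in> P" "rng b \<in> Q" "P \<inter> Q = {}"
    proof -
      have "src b \<in> topspace (gtop G)" "rng b \<in> topspace (gtop G)" using b(2) by simp_all
      then show thesis using hausdorff b(5) that unfolding Hausdorff_space_def disjnt_def by metis
    qed
    \<comment> \<open>An arrow of \<open>B\<close> starting in \<open>?W\<close> is the only one in
      \<open>B\<close> with its source, so it ends in \<open>Q\<close>, which is disjoint from
      \<open>P\<close> and hence from \<open>?W\<close>.\<close>
    let ?W = "W1 \<inter> P \<inter> src ` (B \<inter> {a \<in> Arr. rng a \<in> Q})"
    have "openin (unit_top G) (src ` (B \<inter> {a \<in> Arr. rng a \<in> Q}))"
      using open_map_src openin_Int [OF B(1) openin_rng_vimage [OF PQ(2)]] by (simp add: open_map_def)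
    then have "openin (gtop G) ?W" using W1(1) PQ(1) by (simp add: openin_unit_top openin_Int)
    moreover have "src b \<in> ?W" using b PQ by blast
    moreover have "\<not> (src b' \<in> ?W \<and> rng b' \<in> ?W)" if b': "b' \<in> \<Union>(insert B F)" for b'
    proof
      assume *: "src b' \<in> ?W \<and> rng b' \<in> ?W"
      then have "b' \<in> B" using b' W1(4) by blast
      moreover obtain d where "d \<in> B" "rng d \<in> Q" "src d = src b'" using * by auto
      ultimately have "rng b' \<in> Q" using inj_onD [OF B(2), of d b'] by simp
      then show False using * PQ(5) by blast
    qed
    ultimately show ?thesis using W1(2) by blast
  qed
qed

text \<open>Off the units the support of \<open>f\<close> is compact and open, so finitely many
  bisections without units cover it. Choose \<open>W'\<close> so small that none of their arrows
  joins two of its points; cutting \<open>f\<close> by \<open>ind W'\<close> on both sides then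
  removes everything off the units.\<close>

lemma ideal_contains_ind:
  assumes I: "ideal I R" and f: "f \<in> I" "f \<in> grade \<one>\<^bsub>\<Gamma>\<^esub>"
    and x: "x \<in> gunits G" "f x \<noteq> \<zero>" and W: "openin (gtop G) W" "x \<in> W"
  shows "\<exists>W'. compact_open_bisection G W' \<and> W' \<noteq> {} \<and> W' \<subseteq> W \<inter> gunits G \<and> ind W' \<in> I"
proof -
  have fS: "f \<in> S" by (rule grade_span [OF f(2)])
  let ?N = "{a. f a \<noteq> \<zero>} - gunits G"
  have oN: "openin (gtop G) ?N" by (rule openin_Diff_compact [OF openin_support [OF fS] compactin_units])
  have cN: "compactin (gtop G) ?N"
  proof -
    have "closedin (gtop G) ?N"
      by (rule closedin_diff [OF compactin_closed [OF compactin_support [OF fS]] openin_gtop_units])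
    then show ?thesis by (rule closed_compactin [OF compactin_support [OF fS], rotated]) auto
  qed
  let ?B = "{B. compact_open_bisection G B \<and> B \<subseteq> ?N}"
  have "?N \<subseteq> \<Union>?B"
  proof
    fix a assume "a \<in> ?N"
    from ex_cob [OF oN this] show "a \<in> \<Union>?B" by blast
  qed
  moreover have "\<forall>B\<in>?B. openin (gtop G) B" by (simp add: cob_iff)
  ultimately obtain F where F: "finite F" "F \<subseteq> ?B" "?N \<subseteq> \<Union>F"
    using cN unfolding compactin_def by meson
  \<comment> \<open>Constancy of \<open>f\<close> on \<open>?W\<close> makes the part that survives
    the cutting a multiple of an indicator.\<close>
  let ?W = "W \<inter> gunits G \<inter> {a \<in> Arr. f a = f x}"
  have oW: "openin (gtop G) ?W"
    using W(1) openin_gtop_units loc_const_open [of f "\<lambda>v. v = f x"] fS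
    by (simp add: openin_Int span_iff)
  have "\<exists>W'. openin (gtop G) W' \<and> W' \<subseteq> ?W \<and> W' \<noteq> {} \<and> (\<forall>b\<in>\<Union>F. \<not> (src b \<in> W' \<and> rng b \<in> W'))"
  proof (rule shrink_off_bisections [OF F(1) _ oW])
    fix B assume "B \<in> F"
    then have B: "compact_open_bisection G B" "B \<subseteq> ?N" using F(2) by auto
    moreover have "c b = \<one>\<^bsub>\<Gamma>\<^esub>" if "b \<in> B" for b using that B(2) grade_c [OF f(2)] by blast
    ultimately show "open_bisection G B \<and> B \<inter> gunits G = {} \<and> (\<forall>b\<in>B. c b = \<one>\<^bsub>\<Gamma>\<^esub>)"
      by (auto simp: compact_open_bisection_def)
  next
    show "?W \<subseteq> gunits G" by blast
  qed (use x W in auto)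
  then obtain W1 y where W1: "openin (gtop G) W1" "W1 \<subseteq> ?W" "y \<in> W1"
    "\<forall>b\<in>\<Union>F. \<not> (src b \<in> W1 \<and> rng b \<in> W1)" by blast
  obtain W' where W': "compact_open_bisection G W'" "y \<in> W'" "W' \<subseteq> W1"
    using ex_cob [OF W1(1,3)] .
  have W'u: "W' \<subseteq> gunits G" using W' W1 by blast
  have iS: "ind W' \<in> S" using W'(1) by simp
  let ?k = "inv f x"
  have k: "?k \<in> carrier K" "?k \<otimes> f x = \<one>" using x(2) fS K.field_Units by auto
  let ?g = "conv (ind W') (conv f (ind W'))"
  have g: "?g a = f x \<otimes> ind W' a" for a
  proof (cases "a \<in> Arr \<and> rng a \<in> W' \<and> src a \<in> W'")
    case True
    then have ga: "?g a = f a"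
      using conv_unit_ind_left [OF W'(1) W'u conv_span [OF fS iS], of a]
        conv_unit_ind_right [OF W'(1) W'u fS, of a] by simp
    show ?thesis
    proof (cases "a \<in> gunits G")
      case u: True
      then have "a \<in> W'" using True by simp
      moreover have "f a = f x" using \<open>a \<in> W'\<close> W'(3) W1(2) by blast
      ultimately show ?thesis using ga fS by (simp add: char_fun_def)
    next
      case False
      then have "a \<notin> W'" using W'u by blast
      have "f a = \<zero>"
      proof (rule ccontr)
        assume "f a \<noteq> \<zero>"
        then have "a \<in> \<Union>F" using False F(3) by blast
        then show False using W1(4) True W'(3) by blast
      qed
      then show ?thesis using ga \<open>a \<notin> W'\<close> fS by (simp add: char_fun_def)
    qed
  next
    case False
    then have "a \<notin> W'" using W'u unit_simps(1-3) [of a] by auto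
    moreover have "?g a = \<zero>"
      using False conv_unit_ind_left [OF W'(1) W'u conv_span [OF fS iS], of a]
        conv_unit_ind_right [OF W'(1) W'u fS, of a] by auto
    ultimately show ?thesis using fS by (simp add: char_fun_def)
  qed
  \<comment> \<open>Closure under scalars is not an axiom for ideals, so division by
    \<open>f x\<close> is carried out by multiplying with \<open>?k\<close> times
    \<open>ind W'\<close>.\<close>
  have kS: "(\<lambda>a. ?k \<otimes> ind W' a) \<in> S" by (rule steinberg_span.scale [OF k(1) iS])
  have "conv (\<lambda>a. ?k \<otimes> ind W' a) ?g = (\<lambda>a. ?k \<otimes> conv (ind W') ?g a)"
    by (rule conv_scale_left) (use iS fS k in auto)
  also have "\<dots> = ind W'"
  proof
    fix a
    have "conv (ind W') ?g a = f x \<otimes> ind W' a"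
      using conv_unit_ind_left [OF W'(1) W'u, of ?g a] iS fS g [of a] W'u unit_simps(1,3) [of a]
      by (auto simp: char_fun_def)
    then have "?k \<otimes> conv (ind W') ?g a = (?k \<otimes> f x) \<otimes> ind W' a"
      using k(1) fS iS by (simp add: K.m_assoc)
    then show "?k \<otimes> conv (ind W') ?g a = ind W' a" using k iS by simp
  qed
  finally have eq: "conv (\<lambda>a. ?k \<otimes> ind W' a) ?g = ind W'" .
  have "conv f (ind W') \<in> I" using ideal.I_r_closed [OF I f(1), of "ind W'"] iS by simp
  then have "?g \<in> I" using ideal.I_l_closed [OF I, of _ "ind W'"] iS by simp
  then have "conv (\<lambda>a. ?k \<otimes> ind W' a) ?g \<in> I"
    using ideal.I_l_closed [OF I, of ?g "\<lambda>a. ?k \<otimes> ind W' a"] kS by simp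
  then have "ind W' \<in> I" using eq by simp
  moreover have "W' \<subseteq> W \<inter> gunits G" using W'(3) W1(2) by blast
  ultimately show ?thesis using W'(1,2) by blast
qed

text \<open>The component of \<open>f\<close> in degree \<open>c a\<close> is translated by a
  bisection through \<open>ginverse a\<close> of the inverse degree. The result has the identity
  degree and takes the value \<open>f a\<close> at the unit \<open>src a\<close>, so
  \<open>ideal_contains_ind\<close> applies.\<close>

lemma graded_ideal_contains_ind:
  assumes I: "graded_ideal R \<Gamma> grade I" and f: "f \<in> I" "f a \<noteq> \<zero>"
    and W: "openin (gtop G) W" "src a \<in> W"
  shows "\<exists>W'. compact_open_bisection G W' \<and> W' \<noteq> {} \<and> W' \<subseteq> W \<inter> gunits G \<and> ind W' \<in> I"
proof -
  have id: "ideal I R" using I by (simp add: graded_ideal_def)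
  have "I \<subseteq> S" using additive_subgroup.a_subset [OF ideal.axioms(1) [OF id]] by simp
  then have a: "a \<in> Arr" using f span_Arr by blast
  obtain h where h: "h \<in> I" "h \<in> grade (c a)" "h a = f a"
    using graded_ideal_component [OF I f(1) a] .
  have hS: "h \<in> S" by (rule grade_span [OF h(2)])
  have "ginverse a \<in> {b \<in> Arr. c b = inv\<^bsub>\<Gamma>\<^esub> c a}" using a c_inv by simp
  then obtain B where B: "compact_open_bisection G B" "ginverse a \<in> B" "B \<subseteq> {b \<in> Arr. c b = inv\<^bsub>\<Gamma>\<^esub> c a}"
    using ex_cob [OF openin_c [of "\<lambda>g. g = inv\<^bsub>\<Gamma>\<^esub> c a"]] by blast
  let ?g = "conv (ind B) h"
  have gS: "?g \<in> S" using B(1) hS by simp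
  have "?g (src a) = h (ginverse (ginverse a) \<cdot> src a)"
    by (rule conv_ind_left [OF B(1) hS _ B(2)]) (use a in simp_all)
  then have nz: "?g (src a) \<noteq> \<zero>" using a h(3) f(2) by simp
  have "c x = \<one>\<^bsub>\<Gamma>\<^esub>" if gx: "?g x \<noteq> \<zero>" for x
  proof -
    obtain u v where uv: "u \<in> Arr" "v \<in> Arr" "src u = rng v" "x = u \<cdot> v" "ind B u \<noteq> \<zero>" "h v \<noteq> \<zero>"
      using conv_nonzeroE [OF ind_span [OF B(1)] hS gx] .
    then have "u \<in> B" by (auto simp: char_fun_def split: if_splits)
    then have "c u = inv\<^bsub>\<Gamma>\<^esub> c a" using B(3) by blast
    moreover have "c v = c a" using grade_c [OF h(2) uv(6)] .
    ultimately show ?thesis using uv c_mult [OF uv(1-3)] a by simp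
  qed
  then have "?g \<in> grade \<one>\<^bsub>\<Gamma>\<^esub>" using gS by (simp add: steinberg_grade_def)
  moreover have "?g \<in> I" using ideal.I_l_closed [OF id h(1), of "ind B"] B(1) by simp
  ultimately show ?thesis
    using ideal_contains_ind [where f = ?g and x = "src a", OF id _ _ _ nz W] a by simp
qed

text \<open>The hypothesis is applied to the set of sources of supports of \<open>I\<close>, which
  is open because \<open>src\<close> is an open map; the indicator of the resulting compact open
  \<open>?V\<close> is the required projection.\<close>

lemma quasi_Baer_if_compact_interior:
  assumes compact: "\<And>U. \<lbrakk>openin (unit_top G) U; invariant G U\<rbrakk> \<Longrightarrow>
      compactin (unit_top G) (unit_top G interior_of (gunits G - U))"
    and I: "graded_ideal R \<Gamma> grade I"
  shows "\<exists>p. projection R star p \<and> homogeneous \<Gamma> grade p \<and>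
    right_annihilator R I = (\<lambda>r. p \<otimes>\<^bsub>R\<^esub> r) ` carrier R"
proof -
  have id: "ideal I R" using I by (simp add: graded_ideal_def)
  have IS: "I \<subseteq> S" using additive_subgroup.a_subset [OF ideal.axioms(1) [OF id]] by simp
  let ?U = "\<Union>f\<in>I. src ` {a. f a \<noteq> \<zero>}"
  let ?V = "unit_top G interior_of (gunits G - ?U)"
  have UG: "?U \<subseteq> gunits G" using IS span_Arr by fastforce
  have "openin (unit_top G) (src ` {a. f a \<noteq> \<zero>})" if "f \<in> I" for f
    using that IS open_map_src openin_support [of f] by (auto simp: open_map_def)
  then have oU: "openin (unit_top G) ?U" by auto
  \<comment> \<open>Right multiplication by a bisection through \<open>ginverse a\<close> moves the
    nonzero value at \<open>b\<close> to \<open>b \<cdot> ginverse a\<close>, whose source is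
    \<open>rng a\<close>.\<close>
  have "rng a \<in> ?U" if a: "a \<in> Arr" "src a \<in> ?U" for a
  proof -
    obtain f b where fb: "f \<in> I" "f b \<noteq> \<zero>" "src b = src a" using a(2) by auto
    then have fS: "f \<in> S" and b: "b \<in> Arr" using IS span_Arr by blast+
    obtain B where B: "compact_open_bisection G B" "ginverse a \<in> B"
      using ex_cob [of Arr "ginverse a"] a(1) by auto
    have "conv f (ind B) (b \<cdot> ginverse a) = f (b \<cdot> ginverse a \<cdot> ginverse (ginverse a))"
      by (rule conv_ind_right [OF B(1) fS _ B(2)]) (use a(1) b fb(3) in simp_all)
    also have "\<dots> = f b" using a(1) b fb(3) by simp
    finally have "conv f (ind B) (b \<cdot> ginverse a) \<noteq> \<zero>" using fb(2) by simp
    moreover have "conv f (ind B) \<in> I" using ideal.I_r_closed [OF id fb(1), of "ind B"] B(1) by simp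
    moreover have "src (b \<cdot> ginverse a) = rng a" using a(1) b fb(3) by simp
    ultimately show ?thesis by force
  qed
  then have "invariant G ?U" using UG by (simp add: invariant_def)
  then have cV: "compactin (unit_top G) ?V" using compact [OF oU] by blast
  have V: "compact_open_bisection G ?V" "?V \<subseteq> gunits G"
    using cV openin_interior_of [of "unit_top G" "gunits G - ?U"] cob_units
    by (auto simp only: openin_unit_top compactin_unit_top)
  have "right_annihilator R I = supported (\<lambda>a. rng a \<in> ?V)"
  proof (rule right_annihilator_eq [OF IS UG])
    fix W x assume W: "openin (gtop G) W" "x \<in> W" "x \<in> ?U"
    then obtain f a where "f \<in> I" "f a \<noteq> \<zero>" "x = src a" by blast
    then show "\<exists>W'. compact_open_bisection G W' \<and> W' \<noteq> {} \<and> W' \<subseteq> W \<inter> gunits G \<and> ind W' \<in> I"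
      using graded_ideal_contains_ind [OF I _ _ W(1)] W(2) by blast
  qed blast
  then have "right_annihilator R I = (\<lambda>r. ind ?V \<otimes>\<^bsub>R\<^esub> r) ` carrier R"
    using supported_rng_eq_ind_mult [OF V] by simp
  then show ?thesis using projection_ind [OF V] by blast
qed

text \<open>In the Hausdorff unit space a compact open set is clopen; its complement is its own
  interior and is closed in a compact space.\<close>

lemma compactin_interior_Diff:
  assumes "compactin (unit_top G) U" "openin (unit_top G) U"
  shows "compactin (unit_top G) (unit_top G interior_of (gunits G - U))"
proof -
  have "Hausdorff_space (unit_top G)"
    unfolding unit_top_def by (rule Hausdorff_space_subtopology [OF hausdorff])
  then have "closedin (unit_top G) U" using assms(1) by (rule compactin_imp_closedin)
  then have "unit_top G interior_of (gunits G - U) = gunits G - U"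
    using openin_diff [OF openin_topspace, of "unit_top G" U] by (simp add: interior_of_openin)
  moreover have "closedin (unit_top G) (gunits G - U)"
    using closedin_diff [OF closedin_topspace assms(2)] by simp
  ultimately show ?thesis using closedin_compact_space [OF compact_units] by simp
qed

end

theorem theorem3p3:
  fixes K :: "('k, 'm) ring_scheme" and \<sigma> :: "'k \<Rightarrow> 'k"
    and G :: "('g, 'x) tgroupoid_scheme"
    and \<Gamma> :: "('c, 'n) monoid_scheme" and c :: "'g \<Rightarrow> 'c"
  assumes "field K" and "ring_involution K \<sigma>"
    and "ample_groupoid G" and "Hausdorff_space (gtop G)"
    and "compact_space (unit_top G)"
    and "group \<Gamma>" and "cocycle G \<Gamma> c"
    and "strongly_effective (cocycle_kernel G \<Gamma> c)"
  shows "graded_quasi_Baer_star_ring (steinberg_algebra K G) \<Gamma>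
           (steinberg_grade K G c) (steinberg_star K \<sigma> G)
         \<longleftrightarrow> (\<forall>U. openin (unit_top G) U \<and> invariant G U \<longrightarrow>
               compactin (unit_top G) U \<or>
               compactin (unit_top G) (unit_top G interior_of (gunits G - U)))"
proof -
  interpret effective_steinberg_setting G K \<sigma> \<Gamma> c
    using assms
    by (intro effective_steinberg_setting.intro graded_steinberg_setting.intro
        star_steinberg_setting.intro steinberg_setting.intro steinberg_setting_axioms.intro
        star_steinberg_setting_axioms.intro graded_steinberg_setting_axioms.intro
        effective_steinberg_setting_axioms.intro)
  show ?thesis
  proof (intro iffI allI impI)
    fix U assume "graded_quasi_Baer_star_ring R \<Gamma> grade star" "openin (unit_top G) U \<and> invariant G U"
    then show "compactin (unit_top G) U \<or>
        compactin (unit_top G) (unit_top G interior_of (gunits G - U))"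
      using compact_interior_if_quasi_Baer by blast
  next
    assume "\<forall>U. openin (unit_top G) U \<and> invariant G U \<longrightarrow> compactin (unit_top G) U \<or>
        compactin (unit_top G) (unit_top G interior_of (gunits G - U))"
    \<comment> \<open>The first alternative implies the second, so the disjunction always yields a
      compact interior.\<close>
    then have "compactin (unit_top G) (unit_top G interior_of (gunits G - U))"
      if "openin (unit_top G) U" "invariant G U" for U
      using that compactin_interior_Diff by blast
    then show "graded_quasi_Baer_star_ring R \<Gamma> grade star"
      by (intro graded_quasi_Baer_star_ring.intro graded_quasi_Baer_star_ring_axioms.intro
          graded_star_ring_R quasi_Baer_if_compact_interior)
  qed
qed

end
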